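(* Let $n,k,d$ be integers with $k\ge 3$ and $d\ge5$. There exists an optimal quaternary $[n,k,d]$ $(r,\delta)$-LRC code with $r=2$ and $\delta=3$ if and only if one of the following holds: (1) $n=d+4$, $k=3$, $5\le d\le 12$; (2) $d=8$ and $(n,k)=(16,5)$ or $(n,k)=(20,7)$; (3) $d=12$ and $(n,k)=(20,5)$.
   Context: Quaternary means over $\mathbb{F}_4$. For a linear code $\mathcal C\subseteq\mathbb{F}_q^n$ and $R\subseteq[n]=\{1,\dots,n\}$, $\mathcal C|_R$ is the code obtained by puncturing (deleting) the coordinates outside $R$. An $[n,k,d]$ linear code $\mathcal C$ is an $(r,\delta)$-LRC code if for every $i\in[n]$ there is $R_i\subseteq[n]$ with $i\in R_i$, $|R_i|\le r+\delta-1$, such that $\mathcal C|_{R_i}$ has minimum distance at least $\delta$ (every nonzero word has weight at least $\delta$). Every such code satisfies $d\le n-k+1-(\lceil k/r\rceil-1)(\delta-1)$; it is $d$-optimal if equality holds. An $(r,\delta)$-LRC code is $r$-optimal if it is not an $(r',\delta)$-LRC code for any $1\le r'<r$. "Optimal $(r,\delta)$-LRC code" means an $(r,\delta)$-LRC code that is both $d$-optimal and $r$-optimal, with $d\ge\delta>2$ and $k>r\ge1$. *)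

theory Defs
  imports Complex_Main "HOL-Library.Function_Algebras" "HOL-Library.Extended_Nat"
    "HOL-Library.Cardinality"
begin

text \<open>
  For a finite set \<open>I\<close> of coordinates, the space \<open>F^I\<close> is represented by the functions
  \<open>nat \<Rightarrow> F\<close> that vanish outside \<open>I\<close>; a code of length \<open>n\<close> uses \<open>I = {1..n}\<close>.
  Deleting the coordinates outside \<open>R\<close> then yields a code in \<open>F^R\<close>.
\<close>

definition word_scale :: "'a::field \<Rightarrow> (nat \<Rightarrow> 'a) \<Rightarrow> nat \<Rightarrow> 'a" where
  "word_scale a x = (\<lambda>i. a * x i)"

global_interpretation word: vector_space "word_scale :: 'a::field \<Rightarrow> (nat \<Rightarrow> 'a) \<Rightarrow> nat \<Rightarrow> 'a"
  by unfold_locales (auto simp: word_scale_def fun_eq_iff algebra_simps)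

definition words :: "nat set \<Rightarrow> (nat \<Rightarrow> 'a::field) set" where
  "words I = {x. \<forall>i. i \<notin> I \<longrightarrow> x i = 0}"

definition weight :: "(nat \<Rightarrow> 'a::field) \<Rightarrow> nat" where
  "weight x = card {i. x i \<noteq> 0}"

text \<open>The minimum distance of a linear code; it is \<open>\<infinity>\<close> for the zero code, so that
  \<open>min_distance C \<ge> m\<close> says exactly that every nonzero word has weight at least \<open>m\<close>.\<close>

definition min_distance :: "(nat \<Rightarrow> 'a::field) set \<Rightarrow> enat" where
  "min_distance C = (INF c\<in>C - {0}. enat (weight c))"

definition puncture :: "nat set \<Rightarrow> (nat \<Rightarrow> 'a::field) set \<Rightarrow> (nat \<Rightarrow> 'a) set" where
  "puncture R C = (\<lambda>c i. if i \<in> R then c i else 0) ` C"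

definition linear_code :: "nat \<Rightarrow> nat \<Rightarrow> nat \<Rightarrow> (nat \<Rightarrow> 'a::field) set \<Rightarrow> bool" where
  "linear_code n k d C \<longleftrightarrow>
     C \<subseteq> words {1..n} \<and> word.subspace C \<and> word.dim C = k \<and> min_distance C = enat d"

definition has_locality :: "nat \<Rightarrow> nat \<Rightarrow> nat \<Rightarrow> (nat \<Rightarrow> 'a::field) set \<Rightarrow> bool" where
  "has_locality n r \<delta> C \<longleftrightarrow>
     (\<forall>i\<in>{1..n}. \<exists>R\<subseteq>{1..n}. i \<in> R \<and> int (card R) \<le> int r + int \<delta> - 1 \<and>
        min_distance (puncture R C) \<ge> enat \<delta>)"

definition LRC_code :: "nat \<Rightarrow> nat \<Rightarrow> nat \<Rightarrow> nat \<Rightarrow> nat \<Rightarrow> (nat \<Rightarrow> 'a::field) set \<Rightarrow> bool" where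
  "LRC_code n k d r \<delta> C \<longleftrightarrow> linear_code n k d C \<and> has_locality n r \<delta> C"

definition d_optimal :: "nat \<Rightarrow> nat \<Rightarrow> nat \<Rightarrow> nat \<Rightarrow> nat \<Rightarrow> bool" where
  "d_optimal n k d r \<delta> \<longleftrightarrow>
     int d = int n - int k + 1 - (\<lceil>real k / real r\<rceil> - 1) * (int \<delta> - 1)"

definition r_optimal :: "nat \<Rightarrow> nat \<Rightarrow> nat \<Rightarrow> nat \<Rightarrow> nat \<Rightarrow> (nat \<Rightarrow> 'a::field) set \<Rightarrow> bool" where
  "r_optimal n k d r \<delta> C \<longleftrightarrow> (\<forall>r'. 1 \<le> r' \<and> r' < r \<longrightarrow> \<not> LRC_code n k d r' \<delta> C)"

definition optimal_LRC_code ::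
    "nat \<Rightarrow> nat \<Rightarrow> nat \<Rightarrow> nat \<Rightarrow> nat \<Rightarrow> (nat \<Rightarrow> 'a::field) set \<Rightarrow> bool" where
  "optimal_LRC_code n k d r \<delta> C \<longleftrightarrow>
     LRC_code n k d r \<delta> C \<and> d_optimal n k d r \<delta> \<and> r_optimal n k d r \<delta> C \<and>
     d \<ge> \<delta> \<and> \<delta> > 2 \<and> k > r \<and> r \<ge> 1"

end

theory Submission
  imports Defs "HOL-Computational_Algebra.Polynomial" "HOL-Library.FuncSet" "HOL-Library.Product_Plus"
begin

text \<open>
  For a subcode \<open>V\<close>, compare \<open>dim V\<close> with the number of its common zeros. Imposing zeros on a
  repair group lowers the dimension by \<open>j \<in> {1, 2}\<close> and creates at least \<open>j + 2\<close> new zeros, so a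
  greedy choice of groups produces small subcodes with many zeros; Plotkin's average over a
  two-dimensional subcode then bounds \<open>d\<close>. For even \<open>k\<close> this gives \<open>d \<le> 4\<close>; for odd \<open>k\<close> it gives
  \<open>d \<le> 12\<close> and at most \<open>2 (k - dim V)\<close> zeros for every nonzero \<open>V\<close>. For \<open>k \<ge> 5\<close> the latter
  forces the repair groups to partition the coordinates into 4-sets, so 4 divides \<open>d\<close>. Six
  groups are too many: the low-weight words supported on two or three groups can be normalised so
  that each is determined by one of three nonzero scalars, and pigeonhole yields a word of weight
  below \<open>d\<close>.

  Conversely, words \<open>a j + b j * x\<close> with coordinates \<open>(j, x)\<close>, where \<open>a\<close> and \<open>b\<close> run through
  (extended) Reed--Solomon codes, give the three codes of dimension at least 5, and affine
  functions on unions of lines of the affine plane of order 4 give those of dimension 3.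
\<close>

section \<open>Dimension and common zeros of subcodes\<close>

text \<open>Coordinates with respect to a basis identify \<open>V\<close> with the functions from
  the basis to the field. Over a finite field, dimensions can thus be compared by counting
  words.\<close>

lemma card_subspace:
  fixes V :: "(nat \<Rightarrow> 'a::field) set"
  assumes "word.subspace V" "finite V"
  shows "card V = CARD('a) ^ word.dim V"
proof -
  obtain B where B: "B \<subseteq> V" "word.independent B" "V \<subseteq> word.span B" "card B = word.dim V"
    using word.basis_exists by blast
  have fB: "finite B"
    using B(1) assms(2) finite_subset by blast
  have span: "V = word.span B"
    using word.span_minimal[OF B(1) assms(1)] B(3) by blast
  let ?f = "\<lambda>u. \<Sum>v\<in>B. word_scale (u v) v"
  have "?f ` (B \<rightarrow>\<^sub>E UNIV) = V"
  proof -
    \<comment> \<open>\<open>span_finite\<close> ranges over all scalar functions, while counting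
      needs extensional ones; restricting to \<open>B\<close> leaves the sum unchanged.\<close>
    have "?f u \<in> ?f ` (B \<rightarrow>\<^sub>E UNIV)" for u :: "(nat \<Rightarrow> 'a) \<Rightarrow> 'a"
    proof (rule image_eqI[of _ _ "restrict u B"])
      show "?f u = ?f (restrict u B)"
        by (rule sum.cong) auto
    qed auto
    then show ?thesis
      unfolding span word.span_finite[OF fB] by blast
  qed
  moreover have "inj_on ?f (B \<rightarrow>\<^sub>E UNIV)"
  proof (rule inj_onI)
    fix u u' :: "(nat \<Rightarrow> 'a) \<Rightarrow> 'a"
    assume u: "u \<in> B \<rightarrow>\<^sub>E UNIV" "u' \<in> B \<rightarrow>\<^sub>E UNIV" "?f u = ?f u'"
    have "(\<Sum>v\<in>B. word_scale (u v - u' v) v) = 0"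
      using u(3) by (simp add: word.scale_left_diff_distrib sum_subtractf)
    then have "u v - u' v = 0" if "v \<in> B" for v
      using word.independentD[OF B(2) fB, of "\<lambda>v. u v - u' v"] that by blast
    then show "u = u'"
      using u(1,2) by (intro PiE_ext) auto
  qed
  ultimately have "card V = card (B \<rightarrow>\<^sub>E (UNIV :: 'a set))"
    using card_image by fastforce
  then show ?thesis
    using card_funcsetE[OF fB] B(4) by simp
qed

lemma card_field_gt_1:
  assumes "finite (UNIV :: 'a::field set)"
  shows "CARD('a) > 1"
proof -
  have "card {0, 1 :: 'a} \<le> CARD('a)"
    using assms by (intro card_mono) auto
  then show ?thesis by simp
qed

lemma dim_mono_finite:
  fixes V W :: "(nat \<Rightarrow> 'a::field) set"
  assumes "finite (UNIV :: 'a set)" "word.subspace V" "word.subspace W" "V \<subseteq> W" "finite W"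
  shows "word.dim V \<le> word.dim W"
proof -
  have "CARD('a) ^ word.dim V \<le> CARD('a) ^ word.dim W"
    using card_mono[OF assms(5,4)] card_subspace[OF assms(3,5)]
      card_subspace[OF assms(2) finite_subset[OF assms(4,5)]] by simp
  then show ?thesis
    using card_field_gt_1[OF assms(1)] power_le_imp_le_exp by blast
qed

text \<open>Shortening of a code without deleting the coordinates in \<open>S\<close>, so that the
  result is again a subcode of \<open>V\<close>.\<close>

definition vanishing :: "(nat \<Rightarrow> 'a::field) set \<Rightarrow> nat set \<Rightarrow> (nat \<Rightarrow> 'a) set" where
  "vanishing V S = {c \<in> V. \<forall>i\<in>S. c i = 0}"

text \<open>The complement of the support of \<open>V\<close>. Subcodes with many zeros are those of
  small support, as in generalized Hamming weights.\<close>

definition zeros :: "nat \<Rightarrow> (nat \<Rightarrow> 'a::field) set \<Rightarrow> nat set" where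
  "zeros n V = {i \<in> {1..n}. \<forall>c\<in>V. c i = 0}"

lemma finite_zeros [simp]: "finite (zeros n V)"
  by (simp add: zeros_def)

lemma zeros_subset: "zeros n V \<subseteq> {1..n}"
  by (auto simp: zeros_def)

lemma vanishing_subset: "vanishing V S \<subseteq> V"
  by (auto simp: vanishing_def)

lemma subspace_vanishing:
  "word.subspace V \<Longrightarrow> word.subspace (vanishing V S)"
  by (auto simp: word.subspace_def vanishing_def word_scale_def)

lemma subspaceD:
  assumes "word.subspace V"
  shows "0 \<in> V" "x \<in> V \<Longrightarrow> y \<in> V \<Longrightarrow> x + y \<in> V" "x \<in> V \<Longrightarrow> y \<in> V \<Longrightarrow> x - y \<in> V"
    "x \<in> V \<Longrightarrow> word_scale a x \<in> V"
  by (rule word.subspace_0[OF assms] word.subspace_add[OF assms] word.subspace_diff[OF assms]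
        word.subspace_scale[OF assms]; assumption)+

text \<open>\<open>vanishing V {i}\<close> is the kernel of evaluation at \<open>i\<close>, a
  nonzero functional on \<open>V\<close>, and the line through \<open>v\<close> is a
  complement.\<close>

lemma card_vanishing_single:
  fixes V :: "(nat \<Rightarrow> 'a::field) set"
  assumes "word.subspace V" "v \<in> V" "v i \<noteq> 0"
  shows "card V = CARD('a) * card (vanishing V {i})"
proof -
  let ?f = "\<lambda>(a, c). c + word_scale a v"
  have "bij_betw ?f (UNIV \<times> vanishing V {i}) V"
  proof (rule bij_betw_imageI)
    show "inj_on ?f (UNIV \<times> vanishing V {i})"
    proof (rule inj_onI, clarify)
      fix a b c e
      assume *: "c \<in> vanishing V {i}" "e \<in> vanishing V {i}"
        "c + word_scale a v = e + word_scale b v"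
      have "a * v i = b * v i"
        using fun_cong[OF *(3), of i] *(1,2) by (simp add: vanishing_def word_scale_def)
      then have "a = b" using assms(3) by simp
      then show "a = b \<and> c = e" using *(3) by simp
    qed
    show "?f ` (UNIV \<times> vanishing V {i}) = V"
    proof
      show "?f ` (UNIV \<times> vanishing V {i}) \<subseteq> V"
      proof clarify
        fix a c assume "c \<in> vanishing V {i}"
        then have "c \<in> V" by (simp add: vanishing_def)
        then show "c + word_scale a v \<in> V"
          by (intro subspaceD(2,4) assms(1,2))
      qed
      show "V \<subseteq> ?f ` (UNIV \<times> vanishing V {i})"
      proof
        fix c assume c: "c \<in> V"
        let ?a = "c i / v i"
        have "c - word_scale ?a v \<in> vanishing V {i}"
          using subspaceD(3)[OF assms(1) c subspaceD(4)[OF assms(1,2)], of ?a] assms(3)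
          unfolding vanishing_def by (simp add: word_scale_def)
        then show "c \<in> ?f ` (UNIV \<times> vanishing V {i})"
          by (intro image_eqI[of _ _ "(?a, c - word_scale ?a v)"]) auto
      qed
    qed
  qed
  from bij_betw_same_card[OF this] show ?thesis
    by (simp add: card_cartesian_product)
qed

lemma vanishing_insert: "vanishing V (insert i S) = vanishing (vanishing V S) {i}"
  by (auto simp: vanishing_def)

lemma vanishing_Un: "vanishing V (S \<union> T) = vanishing (vanishing V S) T"
  by (auto simp: vanishing_def)

lemma dim_vanishing_single:
  fixes V :: "(nat \<Rightarrow> 'a::field) set"
  assumes "finite (UNIV :: 'a set)" "word.subspace V" "finite V" "v \<in> V" "v i \<noteq> 0"
  shows "word.dim V = Suc (word.dim (vanishing V {i}))"
proof -
  have "CARD('a) ^ word.dim V = CARD('a) * CARD('a) ^ word.dim (vanishing V {i})"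
    using card_vanishing_single[OF assms(2,4,5)]
    unfolding card_subspace[OF assms(2,3)]
      card_subspace[OF subspace_vanishing[OF assms(2)] finite_subset[OF vanishing_subset assms(3)]] .
  then have "CARD('a) ^ word.dim V = CARD('a) ^ Suc (word.dim (vanishing V {i}))"
    by simp
  then show ?thesis
    using power_inject_exp[OF card_field_gt_1[OF assms(1)]] by blast
qed

lemma dim_le_dim_vanishing:
  fixes V :: "(nat \<Rightarrow> 'a::field) set"
  assumes "finite (UNIV :: 'a set)" "word.subspace V" "finite V" "finite S"
  shows "word.dim V \<le> word.dim (vanishing V S) + card S"
  using assms(4)
proof (induction S rule: finite_induct)
  case empty
  then show ?case by (simp add: vanishing_def)
next
  case (insert i S)
  let ?W = "vanishing V S"
  have W: "word.subspace ?W" "finite ?W"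
    by (rule subspace_vanishing[OF assms(2)], rule finite_subset[OF vanishing_subset assms(3)])
  have "word.dim ?W \<le> Suc (word.dim (vanishing ?W {i}))"
  proof (cases "\<exists>v\<in>?W. v i \<noteq> 0")
    case True
    then obtain v where "v \<in> ?W" "v i \<noteq> 0" by blast
    from dim_vanishing_single[OF assms(1) W this] show ?thesis by simp
  next
    case False
    then have "vanishing ?W {i} = ?W" by (auto simp: vanishing_def)
    then show ?thesis by simp
  qed
  then show ?case
    using insert unfolding vanishing_insert[of V i S] by simp
qed

lemma nonzero_word_if_dim_pos:
  fixes V :: "(nat \<Rightarrow> 'a::field) set"
  assumes "finite V" "word.subspace V" "word.dim V > 0" "finite (UNIV :: 'a set)"
  obtains c where "c \<in> V" "c \<noteq> 0"
proof -
  have "card V \<noteq> 1"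
    using card_subspace[OF assms(2,1)] one_less_power[OF card_field_gt_1[OF assms(4)] assms(3)]
    by linarith
  then have "V \<noteq> {0}" using card_1_singleton_iff[of V] by simp
  then show ?thesis using subspaceD(1)[OF assms(2)] that by blast
qed

section \<open>Repair groups and the greedy argument\<close>

text \<open>Locality for r = 2 and \<delta> = 3 without forming the punctured code: at most r +
  \<delta> - 1 = 4 coordinates and local distance at least 3. The empty set qualifies.\<close>

definition repair_group :: "(nat \<Rightarrow> 'a::field) set \<Rightarrow> nat set \<Rightarrow> bool" where
  "repair_group C R \<longleftrightarrow> finite R \<and> card R \<le> 4 \<and>
     (\<forall>c\<in>C. (\<exists>i\<in>R. c i \<noteq> 0) \<longrightarrow> card {i \<in> R. c i \<noteq> 0} \<ge> 3)"

lemma repair_group_subset: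
  "repair_group C R \<Longrightarrow> V \<subseteq> C \<Longrightarrow> repair_group V R"
  unfolding repair_group_def by blast

text \<open>Let T be the coordinates of \<open>R\<close> where \<open>V\<close> is not identically
  zero. A word vanishing on all but two of them has weight at most 2 on \<open>R\<close>, hence is
  zero there. So |T| - 2 linear conditions suffice to clear \<open>R\<close>.\<close>

lemma repair_group_drop:
  fixes V :: "(nat \<Rightarrow> 'a::field) set"
  assumes "finite (UNIV :: 'a set)" "word.subspace V" "finite V" "repair_group V R"
    and "v \<in> V" "i \<in> R" "v i \<noteq> 0"
  shows "word.dim V + 2 \<le> word.dim (vanishing V R) + card {j \<in> R. \<exists>c\<in>V. c j \<noteq> 0}"
    and "word.dim (vanishing V R) < word.dim V"
proof -
  let ?T = "{j \<in> R. \<exists>c\<in>V. c j \<noteq> 0}"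
  have fR: "finite R" using assms(4) by (simp add: repair_group_def)
  have "3 \<le> card {j \<in> R. v j \<noteq> 0}"
    using assms(4-7) unfolding repair_group_def by blast
  also have "\<dots> \<le> card ?T"
    using fR assms(5) by (intro card_mono) auto
  finally have T3: "3 \<le> card ?T" .
  have "card ?T - 2 \<le> card ?T" by simp
  then obtain A where A: "A \<subseteq> ?T" "card A = card ?T - 2" "finite A"
    by (rule obtain_subset_with_card_n)
  have "vanishing V A \<subseteq> vanishing V R"
  proof
    fix c assume c: "c \<in> vanishing V A"
    then have cV: "c \<in> V" by (simp add: vanishing_def)
    have "{j \<in> R. c j \<noteq> 0} \<subseteq> ?T - A"
      using c by (auto simp: vanishing_def)
    then have "card {j \<in> R. c j \<noteq> 0} \<le> card (?T - A)"
      using fR by (intro card_mono) auto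
    also have "\<dots> = 2"
      using A T3 by (simp add: card_Diff_subset)
    finally have "card {j \<in> R. c j \<noteq> 0} < 3" by simp
    then have "\<forall>j\<in>R. c j = 0"
      using assms(4) cV unfolding repair_group_def by (meson not_le)
    then show "c \<in> vanishing V R" using cV by (simp add: vanishing_def)
  qed
  then have "word.dim (vanishing V A) \<le> word.dim (vanishing V R)"
    by (intro dim_mono_finite[OF assms(1)] subspace_vanishing assms
        finite_subset[OF vanishing_subset assms(3)])
  moreover have "word.dim V \<le> word.dim (vanishing V A) + card A"
    by (intro dim_le_dim_vanishing assms A)
  ultimately show "word.dim V + 2 \<le> word.dim (vanishing V R) + card ?T"
    using A(2) T3 by linarith
  have "vanishing V R \<subseteq> vanishing V {i}"
    using assms(6) by (auto simp: vanishing_def)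
  then have "word.dim (vanishing V R) \<le> word.dim (vanishing V {i})"
    by (intro dim_mono_finite[OF assms(1)] subspace_vanishing assms
        finite_subset[OF vanishing_subset assms(3)])
  then show "word.dim (vanishing V R) < word.dim V"
    using dim_vanishing_single[OF assms(1-3,5,7)] by simp
qed

lemma finite_words:
  assumes "finite (UNIV :: 'a::field set)" "finite I"
  shows "finite (words I :: (nat \<Rightarrow> 'a) set)"
proof -
  have "words I = {f. \<forall>x. (x \<in> I \<longrightarrow> f x \<in> (UNIV :: 'a set)) \<and> (x \<notin> I \<longrightarrow> f x = 0)}"
    by (auto simp: words_def)
  then show ?thesis
    using finite_set_of_finite_funs[OF assms(2,1), of 0] by simp
qed

lemma weight_add_card_zeros_le:
  assumes "c \<in> V" "V \<subseteq> words {1..n}"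
  shows "weight c + card (zeros n V) \<le> n"
proof -
  have "c \<in> words {1..n}" using assms by blast
  then have sub: "{i. c i \<noteq> 0} \<subseteq> {1..n}" by (auto simp: words_def)
  then have "finite {i. c i \<noteq> 0}" using finite_subset by blast
  then have "weight c + card (zeros n V) = card ({i. c i \<noteq> 0} \<union> zeros n V)"
    unfolding weight_def using assms(1)
    by (intro card_Un_disjoint[symmetric]) (auto simp: zeros_def)
  also have "\<dots> \<le> card {1..n}"
    using sub zeros_subset[of n V] by (intro card_mono) auto
  finally show ?thesis by simp
qed

text \<open>Only a lower bound on the nonzero weights is asked for, so the locale applies both to
  optimal codes and to constructed codes whose exact distance is still to be found.\<close>

locale lrc =
  fixes n d :: nat and C :: "(nat \<Rightarrow> 'a::field) set"
  assumes card_field: "CARD('a) = 4"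
    and C_words: "C \<subseteq> words {1..n}"
    and subspace_C: "word.subspace C"
    and dist: "\<And>c. c \<in> C \<Longrightarrow> c \<noteq> 0 \<Longrightarrow> d \<le> weight c"
    and groups: "\<And>i. i \<in> {1..n} \<Longrightarrow> \<exists>R\<subseteq>{1..n}. i \<in> R \<and> repair_group C R"
begin

lemma finite_field: "finite (UNIV :: 'a set)"
  using card_field card.infinite by fastforce

lemma finite_C: "finite C"
  using finite_words[OF finite_field, of "{1..n}"] C_words finite_subset by blast

lemma finite_sub: "V \<subseteq> C \<Longrightarrow> finite V"
  using finite_C finite_subset by blast

lemma nonzero_coord:
  assumes "V \<subseteq> C" "word.subspace V" "word.dim V > 0"
  obtains v i where "v \<in> V" "i \<in> {1..n}" "v i \<noteq> 0"
proof -
  obtain v where v: "v \<in> V" "v \<noteq> 0"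
    using nonzero_word_if_dim_pos[OF finite_sub[OF assms(1)] assms(2,3) finite_field] by blast
  then obtain i where i: "v i \<noteq> 0" by (auto simp: fun_eq_iff)
  have "v \<in> words {1..n}" using v(1) assms(1) C_words by blast
  then have "i \<in> {1..n}" using i by (auto simp: words_def)
  then show ?thesis using that v(1) i by blast
qed

lemma card_zeros_vanishing:
  assumes "R \<subseteq> {1..n}"
  shows "card (zeros n V) + card {j \<in> R. \<exists>c\<in>V. c j \<noteq> 0} \<le> card (zeros n (vanishing V R))"
proof -
  let ?T = "{j \<in> R. \<exists>c\<in>V. c j \<noteq> 0}"
  have "finite ?T" using finite_subset[OF assms] by simp
  then have "card (zeros n V) + card ?T = card (zeros n V \<union> ?T)"
    by (intro card_Un_disjoint[symmetric]) (auto simp: zeros_def)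
  also have "\<dots> \<le> card (zeros n (vanishing V R))"
  proof (rule card_mono)
    show "zeros n V \<union> ?T \<subseteq> zeros n (vanishing V R)"
      using assms unfolding zeros_def vanishing_def by blast
  qed simp
  finally show ?thesis .
qed

text \<open>At least three and at most four coordinates of \<open>R\<close> are new zeros, and the
  dimension drops by at least one and by at most their number minus 2. A drop of two therefore makes
  all four coordinates of \<open>R\<close> new.\<close>

lemma group_step:
  assumes "V \<subseteq> C" "word.subspace V" "R \<subseteq> {1..n}" "repair_group C R"
    and "i \<in> R" "v \<in> V" "v i \<noteq> 0"
  shows "(word.dim V = word.dim (vanishing V R) + 1 \<and>
        card (zeros n V) + 3 \<le> card (zeros n (vanishing V R))) \<or>
      (word.dim V = word.dim (vanishing V R) + 2 \<and>
        card (zeros n V) + 4 \<le> card (zeros n (vanishing V R)) \<and> card R = 4 \<and> R \<inter> zeros n V = {})"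
proof -
  let ?T = "{j \<in> R. \<exists>c\<in>V. c j \<noteq> 0}"
  note drop = repair_group_drop[OF finite_field assms(2) finite_sub[OF assms(1)]
      repair_group_subset[OF assms(4,1)] assms(6,5,7)]
  have R: "finite R" "card R \<le> 4" using assms(4) by (auto simp: repair_group_def)
  have T: "card ?T \<le> card R" using R by (intro card_mono) auto
  note z = card_zeros_vanishing[OF assms(3), of V]
  consider "word.dim V = word.dim (vanishing V R) + 1" | "word.dim V = word.dim (vanishing V R) + 2"
    using drop T R by linarith
  then show ?thesis
  proof cases
    case 1
    then show ?thesis using drop z by linarith
  next
    case 2
    then have 4: "card ?T = 4" "card R = 4" using drop T R by linarith+
    then have "?T = R" using R by (intro card_subset_eq) auto
    then have "R \<inter> zeros n V = {}" by (auto simp: zeros_def)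
    then show ?thesis using 2 4 z by simp
  qed
qed

text \<open>Three zeros for one dimension are one more than the rate of two per dimension; this
  surplus pays when the parity term falls from 1 to 0.\<close>

lemma greedy_arith_1:
  fixes p w z z' t u :: nat
  assumes "p = w + 1" "z + 3 \<le> z'" "t \<le> w" "z' + 2 * (w - t) \<le> u + (w - t) mod 2"
  shows "z + 2 * (p - t) \<le> u + (p - t) mod 2"
proof -
  have "p - t = Suc (w - t)" using assms by simp
  then show ?thesis using assms(2,4) by (simp add: mod_Suc)
qed

lemma greedy_arith_2:
  fixes p w z z' t u :: nat
  assumes "p = w + 2" "z + 4 \<le> z'" "t \<le> w" "z' + 2 * (w - t) \<le> u + (w - t) mod 2"
  shows "z + 2 * (p - t) \<le> u + (p - t) mod 2"
proof -
  have "p - t = w - t + 2" using assms by simp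
  then show ?thesis using assms(2,4) by simp
qed

text \<open>Clearing one group after another gains at least two zeros per lost dimension. Only a
  last step that must lose exactly one dimension may gain a single zero, and the parity term absorbs
  that deficit.\<close>

lemma greedy:
  assumes "V \<subseteq> C" "word.subspace V" "t \<le> word.dim V"
  shows "\<exists>W\<subseteq>V. word.subspace W \<and> word.dim W = t \<and>
    card (zeros n V) + 2 * (word.dim V - t) \<le> card (zeros n W) + (word.dim V - t) mod 2"
  using assms
proof (induction "word.dim V - t" arbitrary: V rule: less_induct)
  case less
  show ?case
  proof (cases "word.dim V = t")
    case True
    then show ?thesis using less.prems by (intro exI[of _ V]) auto
  next
    case False
    then have gt: "word.dim V > t" using less.prems by simp
    obtain v i where v: "v \<in> V" "i \<in> {1..n}" "v i \<noteq> 0"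
      using nonzero_coord[OF less.prems(1,2)] gt by auto
    obtain R where R: "R \<subseteq> {1..n}" "i \<in> R" "repair_group C R"
      using groups[OF v(2)] by blast
    let ?W = "vanishing V R"
    have W: "?W \<subseteq> C" "word.subspace ?W"
      using less.prems(1) vanishing_subset[of V R] subspace_vanishing[OF less.prems(2)] by auto
    have IH: "\<exists>U\<subseteq>V. word.subspace U \<and> word.dim U = t \<and>
        card (zeros n ?W) + 2 * (word.dim ?W - t) \<le> card (zeros n U) + (word.dim ?W - t) mod 2"
      if "t \<le> word.dim ?W" "word.dim ?W < word.dim V"
      using less.hyps[OF diff_less_mono[OF that(2,1)] W that(1)] vanishing_subset[of V R]
      by blast
    from group_step[OF less.prems(1,2) R(1,3,2) v(1,3)] show ?thesis
    proof (elim disjE conjE)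
      assume *: "word.dim V = word.dim ?W + 1" "card (zeros n V) + 3 \<le> card (zeros n ?W)"
      have "t \<le> word.dim ?W" "word.dim ?W < word.dim V" using *(1) gt by linarith+
      from IH[OF this] obtain U where U: "U \<subseteq> V" "word.subspace U" "word.dim U = t"
        "card (zeros n ?W) + 2 * (word.dim ?W - t) \<le> card (zeros n U) + (word.dim ?W - t) mod 2"
        by blast
      have "card (zeros n V) + 2 * (word.dim V - t) \<le> card (zeros n U) + (word.dim V - t) mod 2"
        using greedy_arith_1[OF * \<open>t \<le> word.dim ?W\<close> U(4)] .
      then show ?thesis using U by blast
    next
      assume *: "word.dim V = word.dim ?W + 2" "card (zeros n V) + 4 \<le> card (zeros n ?W)"
      show ?thesis
      proof (cases "t \<le> word.dim ?W")
        case True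
        moreover have "word.dim ?W < word.dim V" using *(1) by linarith
        ultimately obtain U where U: "U \<subseteq> V" "word.subspace U" "word.dim U = t"
          "card (zeros n ?W) + 2 * (word.dim ?W - t) \<le> card (zeros n U) + (word.dim ?W - t) mod 2"
          using IH by blast
        have "card (zeros n V) + 2 * (word.dim V - t) \<le> card (zeros n U) + (word.dim V - t) mod 2"
          using greedy_arith_2[OF * True U(4)] .
        then show ?thesis using U by blast
      next
        case False
        \<comment> \<open>Clearing the whole group would overshoot: the drop is 2 and only one
          dimension is left to lose. A single coordinate does exactly that.\<close>
        let ?U = "vanishing V {i}"
        have dim: "word.dim V = Suc (word.dim ?U)"
          using dim_vanishing_single[OF finite_field less.prems(2) finite_sub[OF less.prems(1)] v(1,3)] .
        have "{j \<in> {i}. \<exists>c\<in>V. c j \<noteq> 0} = {i}" using v by auto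
        then have "card (zeros n V) + 1 \<le> card (zeros n ?U)"
          using card_zeros_vanishing[of "{i}" V] v(2) by simp
        moreover have "word.dim ?U = t" "word.dim V - t = 1" using dim False *(1) gt by linarith+
        ultimately show ?thesis
          using vanishing_subset[of V "{i}"] subspace_vanishing[OF less.prems(2), of "{i}"]
          by (intro exI[of _ ?U]) simp
      qed
    qed
  qed
qed

lemma dist_add_zeros_le:
  assumes "V \<subseteq> C" "word.subspace V" "word.dim V > 0"
  shows "d + card (zeros n V) \<le> n"
proof -
  obtain v where v: "v \<in> V" "v \<noteq> 0"
    using nonzero_word_if_dim_pos[OF finite_sub[OF assms(1)] assms(2,3) finite_field] by blast
  have "weight v + card (zeros n V) \<le> n"
    using weight_add_card_zeros_le[OF v(1)] assms(1) C_words by blast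
  moreover have "d \<le> weight v" using dist v assms(1) by blast
  ultimately show ?thesis by simp
qed

text \<open>Plotkin's averaging argument: 15 nonzero words, 12 of which are nonzero at any given
  coordinate outside the common zeros.\<close>

lemma plotkin:
  assumes "V \<subseteq> C" "word.subspace V" "word.dim V = 2"
  shows "5 * d + 4 * card (zeros n V) \<le> 4 * n"
proof -
  have fV: "finite V" using finite_sub[OF assms(1)] .
  have card_V: "card V = 16"
    using card_subspace[OF assms(2) fV] assms(3) card_field by simp
  have col: "card {c \<in> V. c i \<noteq> 0} = (if i \<in> zeros n V then 0 else 12 :: nat)" if i: "i \<in> {1..n}" for i
  proof (cases "i \<in> zeros n V")
    case True
    then have empty: "{c \<in> V. c i \<noteq> 0} = {}" unfolding zeros_def by blast
    show ?thesis unfolding empty using True by simp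
  next
    case False
    then obtain v where "v \<in> V" "v i \<noteq> 0" using i unfolding zeros_def by blast
    from card_vanishing_single[OF assms(2) this] have "card (vanishing V {i}) = 4"
      using card_V card_field by simp
    moreover have "{c \<in> V. c i \<noteq> 0} = V - vanishing V {i}" by (auto simp: vanishing_def)
    ultimately show ?thesis
      using False fV card_V card_Diff_subset[of "vanishing V {i}" V] vanishing_subset[of V "{i}"]
      by (simp add: finite_subset)
  qed
  have "15 * d = (\<Sum>c\<in>V - {0}. d)"
    using card_V fV subspaceD(1)[OF assms(2)] by simp
  also have "\<dots> \<le> (\<Sum>c\<in>V - {0}. weight c)"
    using dist assms(1) by (intro sum_mono) auto
  also have "\<dots> \<le> (\<Sum>c\<in>V. weight c)"
    using fV by (intro sum_mono2) auto
  also have "\<dots> = (\<Sum>c\<in>V. \<Sum>i\<in>{1..n}. if c i \<noteq> 0 then 1 else 0)"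
  proof (rule sum.cong)
    fix c assume "c \<in> V"
    then have "c \<in> words {1..n}" using assms(1) C_words by blast
    then have "{i. c i \<noteq> 0} = {i \<in> {1..n}. c i \<noteq> 0}" by (auto simp: words_def)
    then show "weight c = (\<Sum>i\<in>{1..n}. if c i \<noteq> 0 then 1 else 0)"
      unfolding weight_def card_eq_sum by (simp only: sum.inter_filter finite_atLeastAtMost)
  qed simp
  also have "\<dots> = (\<Sum>i\<in>{1..n}. \<Sum>c\<in>V. if c i \<noteq> 0 then 1 else 0 :: nat)"
    by (rule sum.swap)
  also have "\<dots> = (\<Sum>i\<in>{1..n}. if i \<in> zeros n V then 0 else 12 :: nat)"
  proof (rule sum.cong)
    fix i assume "i \<in> {1..n}"
    from col[OF this] show "(\<Sum>c\<in>V. if c i \<noteq> 0 then 1 else 0 :: nat) = (if i \<in> zeros n V then 0 else 12 :: nat)"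
      using fV by (simp add: sum.If_cases Int_def)
  qed simp
  also have "\<dots> = 12 * card ({1..n} - zeros n V)"
    by (simp add: sum.If_cases Diff_eq)
  also have "\<dots> = 12 * (n - card (zeros n V))"
    using zeros_subset[of n V] by (simp add: card_Diff_subset)
  finally show ?thesis
    using card_mono[OF _ zeros_subset, of n V] by simp
qed

end

text \<open>Words of \<open>C\<close> that vanish on \<open>R\<close> become the zero word, which
  the infimum leaves out; this explains the guard on the right.\<close>

lemma min_distance_puncture_ge:
  "enat m \<le> min_distance (puncture R C) \<longleftrightarrow>
    (\<forall>c\<in>C. (\<exists>i\<in>R. c i \<noteq> 0) \<longrightarrow> m \<le> card {i \<in> R. c i \<noteq> 0})"
proof -
  let ?f = "\<lambda>c i. if i \<in> R then c i else 0"
  have "weight (?f c) = card {i \<in> R. c i \<noteq> 0}" for c :: "nat \<Rightarrow> 'a"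
    unfolding weight_def by (rule arg_cong[of _ _ card]) auto
  moreover have "?f c = 0 \<longleftrightarrow> \<not> (\<exists>i\<in>R. c i \<noteq> 0)" for c :: "nat \<Rightarrow> 'a"
    by (auto simp: fun_eq_iff)
  moreover have "enat m \<le> min_distance (puncture R C) \<longleftrightarrow> (\<forall>c\<in>C. ?f c \<noteq> 0 \<longrightarrow> m \<le> weight (?f c))"
    unfolding min_distance_def puncture_def le_INF_iff enat_ord_simps by blast
  ultimately show ?thesis by simp
qed

lemma has_locality_2_3_iff:
  "has_locality n 2 3 C \<longleftrightarrow> (\<forall>i\<in>{1..n}. \<exists>R\<subseteq>{1..n}. i \<in> R \<and> repair_group C R)"
proof -
  have "int (card R) \<le> int 2 + int 3 - 1 \<and> enat 3 \<le> min_distance (puncture R C) \<longleftrightarrow>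
      repair_group C R" if "R \<subseteq> {1..n}" for R
    using that finite_subset[OF that] by (auto simp: repair_group_def min_distance_puncture_ge)
  then show ?thesis unfolding has_locality_def by (metis (no_types, lifting))
qed

context lrc
begin

text \<open>The length assumption is d-optimality for k = 2m. The greedy descent to dimension 2 is
  lossless and yields 4m - 4 zeros, which Plotkin's bound allows only for d \<le> 4.\<close>

lemma even_dim_bound:
  assumes "word.dim C = 2 * m" "m \<ge> 2" "n + 3 = d + 4 * m"
  shows "d \<le> 4"
proof -
  obtain W where W: "W \<subseteq> C" "word.subspace W" "word.dim W = 2"
    "card (zeros n C) + 2 * (word.dim C - 2) \<le> card (zeros n W) + (word.dim C - 2) mod 2"
    using greedy[OF subset_refl subspace_C, of 2] assms(1,2) by auto
  have "(word.dim C - 2) mod 2 = 0" using assms(1) by simp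
  then have "2 * (2 * m - 2) \<le> card (zeros n W)" using W(4) assms(1) by linarith
  then show ?thesis using plotkin[OF W(1-3)] assms(2,3) by linarith
qed

end

section \<open>Codes of odd dimension\<close>

text \<open>For odd k the ceiling of k/2 is (k + 1)/2, so the assumption \<open>length\<close> is
  d-optimality.\<close>

locale odd_lrc = lrc +
  fixes k :: nat
  assumes dim_C: "word.dim C = k" and odd_k: "odd k" and k_ge_3: "k \<ge> 3" and d_ge_5: "d \<ge> 5"
    and length: "n = d + 2 * (k - 1)"
begin

text \<open>Descending an odd number of dimensions to 2 may lose one zero. The remaining 2k - 5
  zeros in Plotkin's bound give d \<le> 12.\<close>

lemma d_le_12: "d \<le> 12"
proof -
  obtain W where W: "W \<subseteq> C" "word.subspace W" "word.dim W = 2"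
    "card (zeros n C) + 2 * (word.dim C - 2) \<le> card (zeros n W) + (word.dim C - 2) mod 2"
    using greedy[OF subset_refl subspace_C, of 2] dim_C k_ge_3 by auto
  have "(word.dim C - 2) mod 2 \<le> 1" by simp
  then have "2 * (k - 2) \<le> card (zeros n W) + 1" using W(4) dim_C by linarith
  then show ?thesis using plotkin[OF W(1-3)] length k_ge_3 by linarith
qed

text \<open>Descending from \<open>V\<close> to dimension 1 or 2, whichever has the parity of
  \<open>word.dim V\<close>, loses no zero. The zeros of the final subcode are bounded by the
  minimum distance or by Plotkin.\<close>

lemma zeros_le:
  assumes "V \<subseteq> C" "word.subspace V" "word.dim V \<ge> 1"
  shows "card (zeros n V) \<le> 2 * (k - word.dim V)"
proof (cases "odd (word.dim V)")
  case True
  obtain W where W: "W \<subseteq> V" "word.subspace W" "word.dim W = 1"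
    "card (zeros n V) + 2 * (word.dim V - 1) \<le> card (zeros n W) + (word.dim V - 1) mod 2"
    using greedy[OF assms] by auto
  have "(word.dim V - 1) mod 2 = 0" using True by simp
  moreover have "d + card (zeros n W) \<le> n"
    using dist_add_zeros_le[OF _ W(2)] W(1,3) assms(1) by simp
  ultimately show ?thesis using W(4) length by linarith
next
  case False
  then have 2: "2 \<le> word.dim V" using assms(3) by (cases "word.dim V = 1") auto
  obtain W where W: "W \<subseteq> V" "word.subspace W" "word.dim W = 2"
    "card (zeros n V) + 2 * (word.dim V - 2) \<le> card (zeros n W) + (word.dim V - 2) mod 2"
    using greedy[OF assms(1,2) 2] by auto
  have "(word.dim V - 2) mod 2 = 0" using False by simp
  moreover have "5 * d + 4 * card (zeros n W) \<le> 4 * n"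
    using plotkin[OF _ W(2,3)] W(1) assms(1) by simp
  \<comment> \<open>Plotkin gives at most 2(k - 1) - d/4 zeros of \<open>W\<close>; since d > 4,
    integrality improves this to 2k - 4.\<close>
  ultimately show ?thesis using W(4) length d_ge_5 2 by linarith
qed

lemma zeros_C: "zeros n C = {}"
  using zeros_le[OF subset_refl subspace_C] dim_C k_ge_3 by simp

text \<open>Three zeros at the price of one dimension would violate \<open>zeros_le\<close>, so
  clearing \<open>R\<close> costs two dimensions. The bound is then 4, which the coordinates of
  \<open>R\<close> already exhaust.\<close>

lemma group_full:
  assumes "R \<subseteq> {1..n}" "R \<noteq> {}" "repair_group C R"
  shows "card R = 4" "word.dim (vanishing C R) + 2 = k" "zeros n (vanishing C R) = R"
proof -
  let ?V = "vanishing C R"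
  obtain i where i: "i \<in> R" using assms(2) by blast
  then obtain v where v: "v \<in> C" "v i \<noteq> 0"
    using zeros_C assms(1) unfolding zeros_def by blast
  have V: "?V \<subseteq> C" "word.subspace ?V"
    using vanishing_subset subspace_vanishing[OF subspace_C] by auto
  have zV: "word.dim ?V \<ge> 1 \<Longrightarrow> card (zeros n ?V) \<le> 2 * (k - word.dim ?V)"
    using zeros_le[OF V] .
  have *: "word.dim C = word.dim ?V + 2 \<and> card (zeros n C) + 4 \<le> card (zeros n ?V) \<and> card R = 4"
    using group_step[OF subset_refl subspace_C assms(1,3) i v] zV dim_C k_ge_3 by linarith
  then show 4: "card R = 4" and dim: "word.dim ?V + 2 = k" using dim_C by auto
  have "R \<subseteq> zeros n ?V" using assms(1) by (auto simp: zeros_def vanishing_def)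
  moreover have "card (zeros n ?V) \<le> card R" using zV 4 dim k_ge_3 by linarith
  ultimately show "zeros n ?V = R" using card_seteq[OF finite_zeros] by blast
qed

text \<open>For r = 1 a repair group would have at most three coordinates, whereas every nonempty
  one has exactly four.\<close>

lemma not_locality_1: "\<not> has_locality n 1 3 C"
proof
  assume loc: "has_locality n 1 3 C"
  obtain i where i: "i \<in> {1..n}"
    using nonzero_coord[OF subset_refl subspace_C] dim_C k_ge_3 by (metis gr0I not_numeral_le_zero)
  then obtain R where R: "R \<subseteq> {1..n}" "i \<in> R" "int (card R) \<le> int 1 + int 3 - 1"
      "enat 3 \<le> min_distance (puncture R C)"
    using loc unfolding has_locality_def by blast
  have "repair_group C R"
    using R finite_subset[OF R(1)] by (auto simp: repair_group_def min_distance_puncture_ge)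
  then show False using group_full(1)[OF R(1)] R(2,3) by fastforce
qed

end

section \<open>Dimension at least five: disjoint groups\<close>

locale odd_lrc_5 = odd_lrc +
  assumes k_ge_5: "k \<ge> 5"
begin

text \<open>The empty repair group is left out, so that every member has exactly four
  elements.\<close>

definition grps :: "nat set set" where
  "grps = {R. R \<subseteq> {1..n} \<and> R \<noteq> {} \<and> repair_group C R}"

lemma grpsD:
  assumes "R \<in> grps"
  shows "R \<subseteq> {1..n}" "repair_group C R" "card R = 4" "finite R"
  using assms group_full(1)[of R] finite_subset[of R "{1..n}"] by (auto simp: grps_def)

text \<open>After \<open>A\<close> is cleared, the zeros are exactly \<open>A\<close>. If clearing
  \<open>B\<close> then cost one dimension, there would be at least 7 zeros in dimension k - 3,
  where \<open>zeros_le\<close> allows 6. So it costs two, which forces \<open>B\<close> to avoid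
  the zeros.\<close>

lemma grps_disjoint:
  assumes "A \<in> grps" "B \<in> grps" "A \<noteq> B"
  shows "A \<inter> B = {}"
proof -
  let ?V = "vanishing C A"
  have A: "A \<subseteq> {1..n}" "A \<noteq> {}" "repair_group C A" and B: "B \<subseteq> {1..n}" "repair_group C B"
    using assms by (auto simp: grps_def)
  have V: "?V \<subseteq> C" "word.subspace ?V"
    using vanishing_subset subspace_vanishing[OF subspace_C] by auto
  note full = group_full[OF A]
  have "\<not> B \<subseteq> A"
    using assms card_subset_eq[of A B] grpsD(3,4) by metis
  then obtain i where i: "i \<in> B" "i \<notin> zeros n ?V" using full(3) by blast
  then obtain v where v: "v \<in> ?V" "v i \<noteq> 0" using B(1) unfolding zeros_def by blast
  let ?W = "vanishing ?V B"
  have W: "?W \<subseteq> C" "word.subspace ?W"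
    using vanishing_subset[of ?V B] V subspace_vanishing[OF V(2)] by auto
  have "card (zeros n ?V) = 4" using full by simp
  then have "B \<inter> zeros n ?V = {}"
    using group_step[OF V B(1,2) i(1) v] zeros_le[OF W] full(2) k_ge_5 by linarith
  then show ?thesis using full(3) by blast
qed

lemma finite_grps: "finite grps"
  by (rule finite_subset[of _ "Pow {1..n}"]) (auto simp: grps_def)

lemma Union_grps: "\<Union>grps = {1..n}"
  using groups unfolding grps_def by blast

lemma length_grps: "n = 4 * card grps"
proof -
  have "4 * card grps = card (\<Union>grps)"
    using finite_grps Union_grps grpsD(3) grps_disjoint by (intro card_partition) auto
  then show ?thesis using Union_grps by simp
qed

lemma dim_vanishing_groups:
  assumes "finite J" "J \<subseteq> grps"
  shows "k \<le> word.dim (vanishing C (\<Union>J)) + 2 * card J"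
  using assms
proof (induction J rule: finite_induct)
  case empty
  then show ?case using dim_C by (simp add: vanishing_def)
next
  case (insert R J)
  let ?V = "vanishing C (\<Union>J)"
  have V: "?V \<subseteq> C" "word.subspace ?V"
    using vanishing_subset subspace_vanishing[OF subspace_C] by auto
  have R: "R \<in> grps" using insert.prems by simp
  have "word.dim ?V \<le> word.dim (vanishing ?V R) + 2"
  proof (cases "\<exists>v\<in>?V. \<exists>i\<in>R. v i \<noteq> 0")
    case True
    then obtain v i where "v \<in> ?V" "i \<in> R" "v i \<noteq> 0" by blast
    then show ?thesis using group_step[OF V grpsD(1,2)[OF R]] by fastforce
  next
    case False
    then have "vanishing ?V R = ?V" unfolding vanishing_def by blast
    then show ?thesis by simp
  qed
  moreover have "vanishing C (\<Union>(insert R J)) = vanishing ?V R"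
    using vanishing_Un[of C "\<Union>J" R] by (simp add: Un_commute)
  ultimately show ?case using insert by simp
qed

text \<open>Clearing a group outside \<open>K\<close> costs at most two dimensions and each
  coordinate in \<open>S\<close> at most one, so some dimension remains. This is the source of all
  low-weight words below.\<close>

lemma exists_word_on:
  assumes "K \<subseteq> grps" "finite S" "2 * (card grps - card K) + card S < k"
  obtains c where "c \<in> C" "c \<noteq> 0" "{i. c i \<noteq> 0} \<subseteq> \<Union>K" "\<forall>i\<in>S. c i = 0"
proof -
  let ?J = "grps - K"
  let ?V = "vanishing C (\<Union>?J)"
  have V: "?V \<subseteq> C" "word.subspace ?V"
    using vanishing_subset subspace_vanishing[OF subspace_C] by auto
  have "card ?J = card grps - card K"
    using assms(1) finite_grps by (intro card_Diff_subset) (auto intro: finite_subset)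
  then have "k \<le> word.dim ?V + 2 * (card grps - card K)"
    using dim_vanishing_groups[of ?J] finite_grps by simp
  moreover have "word.dim ?V \<le> word.dim (vanishing ?V S) + card S"
    using dim_le_dim_vanishing[OF finite_field V(2) finite_sub[OF V(1)] assms(2)] .
  ultimately have "word.dim (vanishing ?V S) > 0" using assms(3) by linarith
  moreover have "vanishing ?V S \<subseteq> C" using V vanishing_subset by blast
  ultimately obtain c where c: "c \<in> vanishing ?V S" "c \<noteq> 0"
    using nonzero_word_if_dim_pos[OF finite_sub subspace_vanishing[OF V(2)] _ finite_field]
    by blast
  then have cC: "c \<in> C" and cJ: "\<forall>i\<in>\<Union>?J. c i = 0" and cS: "\<forall>i\<in>S. c i = 0"
    by (auto simp: vanishing_def)
  have "c \<in> words {1..n}" using cC C_words by blast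
  then have "{i. c i \<noteq> 0} \<subseteq> \<Union>grps" unfolding Union_grps by (auto simp: words_def)
  then have "{i. c i \<noteq> 0} \<subseteq> \<Union>K" using cJ by blast
  then show ?thesis using that cC c(2) cS by blast
qed

section \<open>Weights of codewords on single groups\<close>

definition wt :: "nat set \<Rightarrow> (nat \<Rightarrow> 'a) \<Rightarrow> nat" where
  "wt R c = card {i \<in> R. c i \<noteq> 0}"

lemma weight_eq_sum_wt:
  assumes "K \<subseteq> grps" "{i. c i \<noteq> 0} \<subseteq> \<Union>K"
  shows "weight c = (\<Sum>R\<in>K. wt R c)"
proof -
  have "{i. c i \<noteq> 0} = (\<Union>R\<in>K. {i \<in> R. c i \<noteq> 0})" using assms(2) by blast
  moreover have "card (\<Union>R\<in>K. {i \<in> R. c i \<noteq> 0}) = (\<Sum>R\<in>K. card {i \<in> R. c i \<noteq> 0})"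
  proof (intro card_UN_disjoint ballI impI)
    show "finite K" using finite_subset[OF assms(1) finite_grps] .
    show "finite {i \<in> R. c i \<noteq> 0}" if "R \<in> K" for R
      using grpsD(4)[of R] that assms(1) by auto
    show "{i \<in> A. c i \<noteq> 0} \<inter> {i \<in> B. c i \<noteq> 0} = {}" if "A \<in> K" "B \<in> K" "A \<noteq> B" for A B
      using grps_disjoint[of A B] that assms(1) by blast
  qed
  ultimately show ?thesis by (simp only: weight_def wt_def)
qed

lemma wt_le:
  assumes "R \<in> grps"
  shows "wt R c \<le> 4"
proof -
  have "card {i \<in> R. c i \<noteq> 0} \<le> card R"
    by (rule card_mono[OF grpsD(4)[OF assms]]) blast
  then show ?thesis unfolding wt_def grpsD(3)[OF assms] .
qed

lemma wt_eq_0: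
  assumes "R \<in> grps"
  shows "wt R c = 0 \<longleftrightarrow> (\<forall>i\<in>R. c i = 0)"
proof -
  have "finite {i \<in> R. c i \<noteq> 0}" using grpsD(4)[OF assms] by simp
  then show ?thesis unfolding wt_def card_eq_0_iff by blast
qed

lemma wt_eq_4:
  assumes "R \<in> grps" "wt R c = 4" "i \<in> R"
  shows "c i \<noteq> 0"
proof -
  have "{i \<in> R. c i \<noteq> 0} \<subseteq> R" by blast
  moreover have "card {i \<in> R. c i \<noteq> 0} = card R"
    using assms(2) unfolding wt_def grpsD(3)[OF assms(1)] .
  ultimately have "{i \<in> R. c i \<noteq> 0} = R"
    by (rule card_subset_eq[OF grpsD(4)[OF assms(1)]])
  then show ?thesis using assms(3) by blast
qed

lemma wt_ge_3:
  assumes "R \<in> grps" "c \<in> C" "wt R c \<noteq> 0"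
  shows "wt R c \<ge> 3"
proof -
  have "\<exists>i\<in>R. c i \<noteq> 0" using assms(3) unfolding wt_eq_0[OF assms(1)] by blast
  then show ?thesis
    using grpsD(2)[OF assms(1)] assms(2) by (simp add: repair_group_def wt_def)
qed

lemma wt_le_3:
  assumes "R \<in> grps" "i \<in> R" "c i = 0"
  shows "wt R c \<le> 3"
proof -
  have "wt R c \<noteq> 4" using wt_eq_4[OF assms(1) _ assms(2), of c] assms(3) by blast
  then show ?thesis using wt_le[OF assms(1), of c] by linarith
qed

text \<open>Two zeros in a group leave weight at most 2, less than the local distance 3.\<close>

lemma vanish_on_group:
  assumes "R \<in> grps" "c \<in> C" "i \<in> R" "j \<in> R" "i \<noteq> j" "c i = 0" "c j = 0" "p \<in> R"
  shows "c p = 0"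
proof -
  have "wt R c \<le> card (R - {i, j})"
    unfolding wt_def using grpsD(4)[OF assms(1)] assms(6,7) by (intro card_mono) auto
  also have "\<dots> = 2" using assms grpsD(3,4)[OF assms(1)] by simp
  finally have "wt R c = 0" using wt_ge_3[OF assms(1,2)] by linarith
  then show ?thesis using wt_eq_0[OF assms(1)] assms(8) by blast
qed

lemma card_nonzero: "card (UNIV - {0 :: 'a}) = 3"
  using card_Diff_singleton[of "0 :: 'a" UNIV] card_field by simp

text \<open>The words of full weight on a group form a single line: the four ratios of two such words
  take only three nonzero values.\<close>

lemma full_words_agree:
  assumes "R \<in> grps" "u \<in> C" "v \<in> C" "wt R u = 4" "wt R v = 4" "p \<in> R" "u p = v p" "i \<in> R"
  shows "u i = v i"
proof -
  let ?r = "\<lambda>i. u i / v i"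
  have nz: "u j \<noteq> 0" "v j \<noteq> 0" if "j \<in> R" for j
    using wt_eq_4[OF assms(1) assms(4) that] wt_eq_4[OF assms(1) assms(5) that] .
  have "?r ` R \<subseteq> UNIV - {0}" using nz by auto
  then have "card (?r ` R) \<le> card (UNIV - {0 :: 'a})"
    using finite_field by (intro card_mono) auto
  then have "card (?r ` R) \<le> 3" unfolding card_nonzero .
  then have "\<not> inj_on ?r R"
    using card_image[of ?r R] grpsD(3)[OF assms(1)] by linarith
  then obtain a b where ab: "a \<in> R" "b \<in> R" "a \<noteq> b" "?r a = ?r b"
    unfolding inj_on_def by blast
  define r where "r = u a / v a"
  have r: "u a = r * v a" using nz[OF ab(1)] by (simp add: r_def)
  have r': "u b = r * v b" unfolding r_def ab(4) using nz[OF ab(2)] by simp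
  \<comment> \<open>Two coinciding ratios give this combination two zeros in \<open>R\<close>, so it
    vanishes on \<open>R\<close>; the value at \<open>p\<close> then shows r = 1.\<close>
  let ?w = "u - word_scale r v"
  have w: "?w \<in> C" using subspaceD(3,4)[OF subspace_C] assms(2,3) by blast
  have "?w a = 0" "?w b = 0" using r r' by (simp_all add: word_scale_def)
  then have z: "?w j = 0" if "j \<in> R" for j
    using vanish_on_group[OF assms(1) w ab(1-3) _ _ that] by blast
  have "r = 1" using z[OF assms(6)] assms(7) nz[OF assms(6)] by (simp add: word_scale_def)
  then show ?thesis using z[OF assms(8)] by (simp add: word_scale_def)
qed

lemma weight_two_groups:
  assumes "A \<in> grps" "B \<in> grps" "A \<noteq> B" "{i. c i \<noteq> 0} \<subseteq> A \<union> B"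
  shows "weight c = wt A c + wt B c"
  using weight_eq_sum_wt[of "{A, B}" c] assms by simp

lemma weight_three_groups:
  assumes "A \<in> grps" "B \<in> grps" "D \<in> grps" "A \<noteq> B" "D \<noteq> A" "D \<noteq> B"
    "{i. c i \<noteq> 0} \<subseteq> A \<union> B \<union> D"
  shows "weight c = wt A c + wt B c + wt D c"
  using weight_eq_sum_wt[of "{A, B, D}" c] assms by (simp add: Un_assoc)

section \<open>Exclusion of six or more groups\<close>

lemma scaled_word:
  assumes "c \<in> C" "c \<noteq> 0" "c p \<noteq> 0" "{i. c i \<noteq> 0} \<subseteq> T"
  obtains c' where "c' \<in> C" "c' p = 1" "{i. c' i \<noteq> 0} \<subseteq> T" "\<forall>i. c' i = 0 \<longleftrightarrow> c i = 0"
proof (rule that[of "word_scale (1 / c p) c"])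
  let ?c = "word_scale (1 / c p) c"
  show "?c \<in> C" using subspaceD(4)[OF subspace_C assms(1)] .
  show "?c p = 1" using assms(3) by (simp add: word_scale_def)
  show zero: "\<forall>i. ?c i = 0 \<longleftrightarrow> c i = 0" using assms(3) by (simp add: word_scale_def)
  then show "{i. ?c i \<noteq> 0} \<subseteq> T" using assms(4) by blast
qed

text \<open>With at least six groups, four remain besides \<open>A\<close> and \<open>B\<close>, so two of the words
  \<open>f D\<close> share their nonzero value at \<open>q\<close>.\<close>

lemma pigeonhole_words:
  assumes "A \<in> grps" "B \<in> grps" "card grps \<ge> 6"
    and "\<And>D. D \<in> grps \<Longrightarrow> D \<noteq> A \<Longrightarrow> D \<noteq> B \<Longrightarrow> f D q \<noteq> (0 :: 'a)"
  obtains D E where "D \<in> grps" "E \<in> grps" "D \<noteq> E" "D \<noteq> A" "D \<noteq> B" "E \<noteq> A" "E \<noteq> B"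
    "f D q = f E q"
proof -
  let ?G = "grps - {A, B}"
  have "card grps - card {A, B} \<le> card ?G" by (rule diff_card_le_card_Diff) simp
  moreover have "card {A, B} \<le> 2" by (simp add: card_insert_if)
  ultimately have "card ?G \<ge> 4" using assms(3) by linarith
  moreover have "(\<lambda>D. f D q) ` ?G \<subseteq> UNIV - {0}" using assms(4) by auto
  then have "card ((\<lambda>D. f D q) ` ?G) \<le> card (UNIV - {0 :: 'a})"
    using finite_field by (intro card_mono) auto
  then have "card ((\<lambda>D. f D q) ` ?G) \<le> 3" unfolding card_nonzero .
  ultimately have "\<not> inj_on (\<lambda>D. f D q) ?G"
    using card_image[of "\<lambda>D. f D q" ?G] by linarith
  then show ?thesis using that unfolding inj_on_def by blast
qed

lemma obtain_two_grps:
  assumes "card grps \<ge> 6"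
  obtains A B where "A \<in> grps" "B \<in> grps" "A \<noteq> B"
proof -
  have "\<not> card grps \<le> Suc 0" using assms by simp
  then show ?thesis using that unfolding card_le_Suc0_iff_eq[OF finite_grps] by blast
qed

text \<open>A nonzero word on three groups \<open>A\<close>, \<open>B\<close>, \<open>D\<close> must
  have full weight on each. Normalised at \<open>p\<close> in \<open>A\<close>, two such words with
  different \<open>D\<close> agree at \<open>q\<close> in \<open>B\<close>, hence on
  \<open>A\<close> and \<open>B\<close>. Their difference is nonzero of weight at most 8.\<close>

lemma card_grps_le_5_if_d_12:
  assumes "d = 12"
  shows "card grps \<le> 5"
proof (rule ccontr)
  assume "\<not> card grps \<le> 5"
  then have ge6: "card grps \<ge> 6" by simp
  then obtain A B where AB: "A \<in> grps" "B \<in> grps" "A \<noteq> B" by (rule obtain_two_grps)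
  obtain p where p: "p \<in> A" using AB(1) by (auto simp: grps_def)
  obtain q where q: "q \<in> B" using AB(2) by (auto simp: grps_def)
  \<comment> \<open>Equating 4 \<open>card grps\<close> with 12 + 2(k - 1). Hence the words
    supported on any three groups form a space of dimension at least 1.\<close>
  have k: "2 * card grps = k + 5" using length length_grps k_ge_5 assms by linarith
  have "\<exists>c. c \<in> C \<and> c p = 1 \<and> {i. c i \<noteq> 0} \<subseteq> A \<union> B \<union> D \<and>
      wt A c = 4 \<and> wt B c = 4 \<and> wt D c = 4"
    if D: "D \<in> grps" "D \<noteq> A" "D \<noteq> B" for D
  proof -
    have "card {A, B, D} = 3" using AB D by auto
    then have count: "2 * (card grps - card {A, B, D}) + card {} < k" using k by simp
    have "{A, B, D} \<subseteq> grps" using AB D by blast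
    from exists_word_on[OF this finite.emptyI count]
    obtain c where c: "c \<in> C" "c \<noteq> 0" "{i. c i \<noteq> 0} \<subseteq> \<Union>{A, B, D}" .
    then have supp: "{i. c i \<noteq> 0} \<subseteq> A \<union> B \<union> D" by blast
    have w: "wt A x = 4 \<and> wt B x = 4 \<and> wt D x = 4"
      if "x \<in> C" "x \<noteq> 0" "{i. x i \<noteq> 0} \<subseteq> A \<union> B \<union> D" for x
      using weight_three_groups[OF AB(1,2) D(1) AB(3) D(2,3) that(3)] dist[OF that(1,2)] assms
        wt_le[OF AB(1), of x] wt_le[OF AB(2), of x] wt_le[OF D(1), of x] by linarith
    have "c p \<noteq> 0" using wt_eq_4[OF AB(1) _ p, of c] w[OF c(1,2) supp] by blast
    from scaled_word[OF c(1,2) this supp]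
    obtain c' where c': "c' \<in> C" "c' p = 1" "{i. c' i \<noteq> 0} \<subseteq> A \<union> B \<union> D" .
    have "c' \<noteq> 0" using c'(2) by (metis zero_fun_apply zero_neq_one)
    then show ?thesis using c' w[OF c'(1) _ c'(3)] by blast
  qed
  then obtain f where f: "\<And>D. D \<in> grps \<Longrightarrow> D \<noteq> A \<Longrightarrow> D \<noteq> B \<Longrightarrow>
      f D \<in> C \<and> f D p = 1 \<and> {i. f D i \<noteq> 0} \<subseteq> A \<union> B \<union> D \<and>
      wt A (f D) = 4 \<and> wt B (f D) = 4 \<and> wt D (f D) = 4"
    by metis
  have "f D q \<noteq> 0" if "D \<in> grps" "D \<noteq> A" "D \<noteq> B" for D
    using wt_eq_4[OF AB(2) _ q, of "f D"] f[OF that] by blast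
  from pigeonhole_words[where f = f and q = q, OF AB(1,2) ge6 this]
  obtain D E where DE: "D \<in> grps" "E \<in> grps" "D \<noteq> E" "D \<noteq> A" "D \<noteq> B" "E \<noteq> A" "E \<noteq> B"
    "f D q = f E q" .
  note fD = f[OF DE(1,4,5)] and fE = f[OF DE(2,6,7)]
  let ?w = "f D - f E"
  have w: "?w \<in> C" using subspaceD(3)[OF subspace_C] fD fE by blast
  have wA: "?w i = 0" if "i \<in> A" for i
    using full_words_agree[OF AB(1) _ _ _ _ p _ that, of "f D" "f E"] fD fE by simp
  have wB: "?w i = 0" if "i \<in> B" for i
    using full_words_agree[OF AB(2) _ _ _ _ q _ that, of "f D" "f E"] fD fE DE(8) by simp
  have "?w i = 0" if "i \<notin> D \<union> E" for i
  proof (cases "i \<in> A \<or> i \<in> B")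
    case True
    then show ?thesis using wA wB by blast
  next
    case False
    then have "f D i = 0" "f E i = 0" using that fD fE by blast+
    then show ?thesis by simp
  qed
  then have "{i. ?w i \<noteq> 0} \<subseteq> D \<union> E" by blast
  then have "weight ?w \<le> 8"
    using weight_two_groups[OF DE(1-3)] wt_le[OF DE(1), of ?w] wt_le[OF DE(2), of ?w] by simp
  obtain i where i: "i \<in> D" using DE(1) by (auto simp: grps_def)
  have "f D i \<noteq> 0" using wt_eq_4[OF DE(1) _ i, of "f D"] fD by blast
  moreover have "i \<notin> A \<union> B \<union> E"
    using i grps_disjoint[OF DE(1) AB(1) DE(4)] grps_disjoint[OF DE(1) AB(2) DE(5)]
      grps_disjoint[OF DE(1-3)] by blast
  then have "f E i = 0" using fE by blast
  ultimately have "?w i \<noteq> 0" by simp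
  then have "?w \<noteq> 0" by (metis zero_fun_apply)
  then show False using dist[OF w] \<open>weight ?w \<le> 8\<close> assms by linarith
qed

text \<open>The words on \<open>A\<close>, \<open>B\<close>, \<open>D\<close> are now chosen with a
  zero at \<open>p\<close> in \<open>A\<close> and at \<open>q\<close> in \<open>B\<close>, and turn
  out to have weight 3 on each group. Two of them that agree at \<open>p'\<close> and
  \<open>q'\<close> differ by a nonzero word of weight 6.\<close>

lemma card_grps_le_5_if_d_8:
  assumes "d = 8"
  shows "card grps \<le> 5"
proof (rule ccontr)
  assume "\<not> card grps \<le> 5"
  then have ge6: "card grps \<ge> 6" by simp
  then obtain A B where AB: "A \<in> grps" "B \<in> grps" "A \<noteq> B" by (rule obtain_two_grps)
  have two: "\<exists>p p'. p \<in> G \<and> p' \<in> G \<and> p \<noteq> p'" if "G \<in> grps" for G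
  proof -
    have "\<not> card G \<le> Suc 0" using grpsD(3)[OF that] by simp
    then show ?thesis unfolding card_le_Suc0_iff_eq[OF grpsD(4)[OF that]] by blast
  qed
  obtain p p' where p: "p \<in> A" "p' \<in> A" "p \<noteq> p'" using two[OF AB(1)] by blast
  obtain q q' where q: "q \<in> B" "q' \<in> B" "q \<noteq> q'" using two[OF AB(2)] by blast
  \<comment> \<open>From 4 \<open>card grps\<close> = 8 + 2(k - 1). Three groups carry a space of
    words of dimension at least 3, enough for two prescribed zeros; two groups carry dimension at
    least 1.\<close>
  have k: "2 * card grps = k + 3" using length length_grps k_ge_5 assms by linarith
  have "\<exists>c. c \<in> C \<and> c p = 0 \<and> c p' = 1 \<and> c q = 0 \<and> c q' \<noteq> 0 \<and>
      {i. c i \<noteq> 0} \<subseteq> A \<union> B \<union> D \<and> wt D c = 3"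
    if D: "D \<in> grps" "D \<noteq> A" "D \<noteq> B" for D
  proof -
    have "card {A, B, D} = 3" using AB D by auto
    moreover have "card {p, q} \<le> 2" by (simp add: card_insert_if)
    ultimately have count: "2 * (card grps - card {A, B, D}) + card {p, q} < k"
      using k ge6 by linarith
    have "{A, B, D} \<subseteq> grps" "finite {p, q}" using AB D by auto
    from exists_word_on[OF this count]
    obtain c where c: "c \<in> C" "c \<noteq> 0" "{i. c i \<noteq> 0} \<subseteq> \<Union>{A, B, D}"
      and cS: "\<forall>i\<in>{p, q}. c i = 0" .
    have cp: "c p = 0" and cq: "c q = 0" using cS by blast+
    have supp: "{i. c i \<noteq> 0} \<subseteq> A \<union> B \<union> D" using c(3) by blast
    have weight: "wt A c + wt B c + wt D c \<ge> 8"
      using weight_three_groups[OF AB(1,2) D(1) AB(3) D(2,3) supp] dist[OF c(1,2)] assms by simp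
    have le: "wt A c \<le> 3" "wt B c \<le> 3" "wt D c \<le> 4"
      using wt_le_3[where c = c, OF AB(1) p(1) cp] wt_le_3[where c = c, OF AB(2) q(1) cq] wt_le[OF D(1), of c] .
    \<comment> \<open>If \<open>c\<close> vanished on \<open>A\<close> or on \<open>B\<close>, its
      weight would be at most 3 + 4 < 8.\<close>
    have A3: "wt A c = 3" and B3: "wt B c = 3" and D3: "wt D c \<noteq> 0"
      using weight le wt_ge_3[OF AB(1) c(1)] wt_ge_3[OF AB(2) c(1)] by linarith+
    \<comment> \<open>Otherwise a word \<open>e\<close> on \<open>A\<close> and \<open>D\<close>,
      necessarily full on \<open>D\<close>, can be scaled to agree with \<open>c\<close> on
      \<open>D\<close>. Subtracting it leaves a word on \<open>A\<close> and \<open>B\<close> with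
      weight 3 on \<open>B\<close>, so of total weight at most 7.\<close>
    have "wt D c \<noteq> 4"
    proof
      assume D4: "wt D c = 4"
      have "card {A, D} = 2" using D by auto
      then have count: "2 * (card grps - card {A, D}) + card {} < k" using k ge6 by simp
      have "{A, D} \<subseteq> grps" using AB D by blast
      from exists_word_on[OF this finite.emptyI count]
      obtain e where e: "e \<in> C" "e \<noteq> 0" "{i. e i \<noteq> 0} \<subseteq> \<Union>{A, D}" .
      then have esupp: "{i. e i \<noteq> 0} \<subseteq> A \<union> D" by blast
      have De: "wt D e = 4"
        using weight_two_groups[OF AB(1) D(1) D(2)[symmetric] esupp] dist[OF e(1,2)] assms
          wt_le[OF AB(1), of e] wt_le[OF D(1), of e] by linarith
      obtain s where s: "s \<in> D" using D(1) by (auto simp: grps_def)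
      have es: "e s \<noteq> 0" "c s \<noteq> 0" using wt_eq_4[OF D(1) De s] wt_eq_4[OF D(1) D4 s] .
      let ?e = "word_scale (c s / e s) e"
      have e': "?e \<in> C" using subspaceD(4)[OF subspace_C e(1)] .
      have "wt D ?e = wt D e" using es by (simp add: wt_def word_scale_def)
      then have agree: "c i = ?e i" if "i \<in> D" for i
        using full_words_agree[OF D(1) c(1) e' D4 _ s _ that] De es by (simp add: word_scale_def)
      let ?y = "c - ?e"
      have y: "?y \<in> C" using subspaceD(3)[OF subspace_C c(1) e'] .
      have "?y i = 0" if "i \<notin> A" "i \<notin> B" for i
      proof (cases "i \<in> D")
        case True
        then show ?thesis using agree by simp
      next
        case False
        then have "c i = 0" "e i = 0" using that supp esupp by blast+
        then show ?thesis by (simp add: word_scale_def)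
      qed
      then have ysupp: "{i. ?y i \<noteq> 0} \<subseteq> A \<union> B" by blast
      have yB: "?y i = c i" if "i \<in> B" for i
      proof -
        have "e i = 0"
          using esupp that grps_disjoint[OF AB(2,1)] grps_disjoint[OF AB(2) D(1)] AB(3) D(3) by blast
        then show ?thesis by (simp add: word_scale_def)
      qed
      have "{i \<in> B. ?y i \<noteq> 0} = {i \<in> B. c i \<noteq> 0}" using yB by auto
      then have yB3: "wt B ?y = 3" using B3 unfolding wt_def by simp
      have "?y \<noteq> 0"
      proof
        assume "?y = 0"
        then have "wt B ?y = 0" by (simp only: wt_def zero_fun_apply) simp
        then show False using yB3 by simp
      qed
      then show False
        using weight_two_groups[where c = ?y, OF AB ysupp] dist[OF y] assms yB3
          wt_le[OF AB(1), of ?y] by linarith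
    qed
    then have D3: "wt D c = 3" using D3 le wt_ge_3[OF D(1) c(1)] by linarith
    have p': "c p' \<noteq> 0"
      using vanish_on_group[OF AB(1) c(1) p cp] wt_eq_0[OF AB(1), of c] A3
      by (metis zero_neq_numeral)
    have q': "c q' \<noteq> 0"
      using vanish_on_group[OF AB(2) c(1) q cq] wt_eq_0[OF AB(2), of c] B3
      by (metis zero_neq_numeral)
    from scaled_word[OF c(1,2) p' supp]
    obtain c' where c': "c' \<in> C" "c' p' = 1" "{i. c' i \<noteq> 0} \<subseteq> A \<union> B \<union> D"
      "\<forall>i. c' i = 0 \<longleftrightarrow> c i = 0" .
    have "wt D c' = 3" using D3 c'(4) by (simp add: wt_def)
    then show ?thesis using c' cp cq q' by blast
  qed
  then obtain f where f: "\<And>D. D \<in> grps \<Longrightarrow> D \<noteq> A \<Longrightarrow> D \<noteq> B \<Longrightarrow>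
      f D \<in> C \<and> f D p = 0 \<and> f D p' = 1 \<and> f D q = 0 \<and> f D q' \<noteq> 0 \<and>
      {i. f D i \<noteq> 0} \<subseteq> A \<union> B \<union> D \<and> wt D (f D) = 3"
    by metis
  have "f D q' \<noteq> 0" if "D \<in> grps" "D \<noteq> A" "D \<noteq> B" for D
    using f[OF that] by blast
  from pigeonhole_words[where f = f and q = q', OF AB(1,2) ge6 this]
  obtain D E where DE: "D \<in> grps" "E \<in> grps" "D \<noteq> E" "D \<noteq> A" "D \<noteq> B" "E \<noteq> A" "E \<noteq> B"
    "f D q' = f E q'" .
  note fD = f[OF DE(1,4,5)] and fE = f[OF DE(2,6,7)]
  let ?w = "f D - f E"
  have w: "?w \<in> C" using subspaceD(3)[OF subspace_C] fD fE by blast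
  have wA: "?w i = 0" if "i \<in> A" for i
    using vanish_on_group[OF AB(1) w p _ _ that] fD fE by simp
  have wB: "?w i = 0" if "i \<in> B" for i
    using vanish_on_group[OF AB(2) w q _ _ that] fD fE DE(8) by simp
  have "?w i = 0" if "i \<notin> D \<union> E" for i
  proof (cases "i \<in> A \<or> i \<in> B")
    case True
    then show ?thesis using wA wB by blast
  next
    case False
    then have "f D i = 0" "f E i = 0" using that fD fE by blast+
    then show ?thesis by simp
  qed
  then have supp: "{i. ?w i \<noteq> 0} \<subseteq> D \<union> E" by blast
  have disj: "D \<inter> A = {}" "D \<inter> B = {}" "D \<inter> E = {}" "E \<inter> A = {}" "E \<inter> B = {}"
    using grps_disjoint[OF DE(1) AB(1) DE(4)] grps_disjoint[OF DE(1) AB(2) DE(5)]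
      grps_disjoint[OF DE(1-3)] grps_disjoint[OF DE(2) AB(1) DE(6)]
      grps_disjoint[OF DE(2) AB(2) DE(7)] .
  have "f E i = 0" if "i \<in> D" for i using that fE disj by blast
  then have "{i \<in> D. ?w i \<noteq> 0} = {i \<in> D. f D i \<noteq> 0}" by auto
  then have wD: "wt D ?w = 3" using fD unfolding wt_def by simp
  have "f D i = 0" if "i \<in> E" for i using that fD disj by blast
  then have "{i \<in> E. ?w i \<noteq> 0} = {i \<in> E. f E i \<noteq> 0}" by auto
  then have wE: "wt E ?w = 3" using fE unfolding wt_def by simp
  have "?w \<noteq> 0"
  proof
    assume "?w = 0"
    then have "wt D ?w = 0" by (simp only: wt_def zero_fun_apply) simp
    then show False using wD by simp
  qed
  then show False
    using dist[OF w] weight_two_groups[where c = ?w, OF DE(1-3) supp] wD wE assms by linarith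
qed

text \<open>With k = 2m + 1, the partition into 4-sets gives 4 \<open>card grps\<close> = d + 4m, so
  4 divides d and d is 8 or 12. At most five groups then means 4m \<le> 20 - d.\<close>

lemma parameters: "(d = 8 \<and> (n, k) = (16, 5)) \<or> (d = 8 \<and> (n, k) = (20, 7)) \<or> (d = 12 \<and> (n, k) = (20, 5))"
proof -
  obtain m where m: "k = 2 * m + 1" using odd_k by (rule oddE)
  have eq: "4 * card grps = d + 4 * m" using length length_grps m by simp
  then have "d = 4 * (card grps - m)" by simp
  then have "4 dvd d" by (metis dvd_triv_left)
  then have d: "d = 8 \<or> d = 12" using d_le_12 d_ge_5 by presburger
  have "card grps \<le> 5" using d card_grps_le_5_if_d_8 card_grps_le_5_if_d_12 by blast
  then have "m \<le> 3" "d = 12 \<Longrightarrow> m \<le> 2" using d eq by auto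
  moreover have "m = 2 \<or> m \<ge> 3" using m k_ge_5 by linarith
  ultimately show ?thesis using d m length by auto
qed

end

section \<open>Optimality\<close>

lemma d_optimal_even:
  assumes "d_optimal n (2 * m) d 2 3"
  shows "n + 3 = d + 4 * m"
  using assms by (simp add: d_optimal_def)

lemma d_optimal_odd:
  assumes "odd k"
  shows "d_optimal n k d 2 3 \<longleftrightarrow> n = d + 2 * (k - 1)"
proof -
  obtain m where m: "k = 2 * m + 1" using assms by (rule oddE)
  have "\<lceil>real k / real 2\<rceil> = int m + 1"
    unfolding m by (rule ceiling_unique) auto
  then show ?thesis using m by (auto simp: d_optimal_def)
qed

lemma lrc_if_optimal:
  fixes C :: "(nat \<Rightarrow> 'a::field) set"
  assumes "CARD('a) = 4" "optimal_LRC_code n k d 2 3 C"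
  shows "lrc n d C" "word.dim C = k" "d_optimal n k d 2 3"
proof -
  have C: "C \<subseteq> words {1..n}" "word.subspace C" "word.dim C = k" "min_distance C = enat d"
    "has_locality n 2 3 C" "d_optimal n k d 2 3"
    using assms(2) by (auto simp: optimal_LRC_code_def LRC_code_def linear_code_def)
  have "d \<le> weight c" if "c \<in> C" "c \<noteq> 0" for c
  proof -
    have "min_distance C \<le> enat (weight c)"
      unfolding min_distance_def using that by (intro INF_lower) blast
    then show ?thesis using C(4) by simp
  qed
  then show "lrc n d C"
    using assms(1) C(1,2,5) unfolding lrc_def has_locality_2_3_iff by blast
  show "word.dim C = k" "d_optimal n k d 2 3" using C by auto
qed

context odd_lrc
begin

text \<open>The upper bound is the Singleton-type bound for codes with locality: the greedy descent
  to dimension 1 covers an even number k - 1 of dimensions and so yields 2(k - 1) = n - d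
  zeros.\<close>

lemma min_distance_eq: "min_distance C = enat d"
proof (rule antisym)
  obtain W where W: "W \<subseteq> C" "word.subspace W" "word.dim W = 1"
    "card (zeros n C) + 2 * (word.dim C - 1) \<le> card (zeros n W) + (word.dim C - 1) mod 2"
    using greedy[OF subset_refl subspace_C, of 1] dim_C k_ge_3 by auto
  have "(word.dim C - 1) mod 2 = 0" using dim_C odd_k by simp
  then have z: "2 * (k - 1) \<le> card (zeros n W)" using W(4) dim_C by linarith
  obtain c where c: "c \<in> W" "c \<noteq> 0"
    using nonzero_word_if_dim_pos[OF finite_sub[OF W(1)] W(2) _ finite_field] W(3) by auto
  have "W \<subseteq> words {1..n}" using W(1) C_words by blast
  from weight_add_card_zeros_le[OF c(1) this] have "weight c \<le> d"
    using z length by linarith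
  moreover have "min_distance C \<le> enat (weight c)"
    unfolding min_distance_def using c W(1) by (intro INF_lower) blast
  ultimately show "min_distance C \<le> enat d" by (meson enat_ord_simps(1) order_trans)
  show "enat d \<le> min_distance C"
    unfolding min_distance_def le_INF_iff enat_ord_simps using dist by blast
qed

lemma optimal: "optimal_LRC_code n k d 2 3 C"
proof -
  have "linear_code n k d C"
    unfolding linear_code_def using C_words subspace_C dim_C min_distance_eq by blast
  moreover have "has_locality n 2 3 C"
    unfolding has_locality_2_3_iff using groups by blast
  moreover have "r_optimal n k d 2 3 C"
    unfolding r_optimal_def
  proof (intro allI impI)
    fix r' :: nat assume "1 \<le> r' \<and> r' < 2"
    then have "r' = 1" by simp
    then show "\<not> LRC_code n k d r' 3 C" using not_locality_1 by (simp add: LRC_code_def)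
  qed
  ultimately show ?thesis
    unfolding optimal_LRC_code_def LRC_code_def d_optimal_odd[OF odd_k]
    using length k_ge_3 d_ge_5 by simp
qed

end

text \<open>The code is the image of the messages \<open>M\<close> under the evaluation map \<open>\<phi>\<close>; its minimum
  distance need only be bounded from below, as the locality forces equality.\<close>

lemma exists_optimal_code:
  fixes \<phi> :: "'m::ab_group_add \<Rightarrow> 'b \<Rightarrow> 'a::field"
  assumes field: "CARD('a) = 4" and X: "finite X" "card X = n"
    and M: "card M = 4 ^ k" "0 \<in> M" "\<And>x y. x \<in> M \<Longrightarrow> y \<in> M \<Longrightarrow> x - y \<in> M"
    and diff: "\<And>x y p. \<phi> (x - y) p = \<phi> x p - \<phi> y p"
    and scale: "\<And>a x. x \<in> M \<Longrightarrow> \<exists>y\<in>M. \<forall>p. \<phi> y p = a * \<phi> x p"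
    and dist: "\<And>x. x \<in> M \<Longrightarrow> x \<noteq> 0 \<Longrightarrow> d \<le> card {p \<in> X. \<phi> x p \<noteq> 0}"
    and loc: "\<And>p. p \<in> X \<Longrightarrow> \<exists>R\<subseteq>X. p \<in> R \<and> card R = 4 \<and>
      (\<forall>x\<in>M. (\<exists>q\<in>R. \<phi> x q \<noteq> 0) \<longrightarrow> 3 \<le> card {q \<in> R. \<phi> x q \<noteq> 0})"
    and par: "odd k" "k \<ge> 3" "d \<ge> 5" "n = d + 2 * (k - 1)"
  shows "\<exists>C :: (nat \<Rightarrow> 'a) set. optimal_LRC_code n k d 2 3 C"
proof -
  obtain g where g: "bij_betw g {1..n} X"
    using ex_bij_betw_nat_finite_1[OF X(1)] X(2) by blast
  define \<psi> where "\<psi> x i = (if i \<in> {1..n} then \<phi> x (g i) else 0)" for x i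
  have card_pre: "card {i \<in> g -` R \<inter> {1..n}. \<psi> x i \<noteq> 0} = card {q \<in> R. \<phi> x q \<noteq> 0}"
    if "R \<subseteq> X" for R x
  proof -
    have "g ` {i \<in> g -` R \<inter> {1..n}. \<psi> x i \<noteq> 0} = {q \<in> R. \<phi> x q \<noteq> 0}"
    proof
      show "{q \<in> R. \<phi> x q \<noteq> 0} \<subseteq> g ` {i \<in> g -` R \<inter> {1..n}. \<psi> x i \<noteq> 0}"
      proof
        fix q assume q: "q \<in> {q \<in> R. \<phi> x q \<noteq> 0}"
        then have "q \<in> g ` {1..n}" using that bij_betw_imp_surj_on[OF g] by blast
        then obtain i where "i \<in> {1..n}" "q = g i" by blast
        then show "q \<in> g ` {i \<in> g -` R \<inter> {1..n}. \<psi> x i \<noteq> 0}"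
          using q by (auto simp: \<psi>_def)
      qed
    qed (auto simp: \<psi>_def)
    moreover have "inj_on g {i \<in> g -` R \<inter> {1..n}. \<psi> x i \<noteq> 0}"
      by (rule inj_on_subset[OF bij_betw_imp_inj_on[OF g]]) blast
    from card_image[OF this]
    have "card (g ` {i \<in> g -` R \<inter> {1..n}. \<psi> x i \<noteq> 0}) = card {i \<in> g -` R \<inter> {1..n}. \<psi> x i \<noteq> 0}" .
    ultimately show ?thesis by simp
  qed
  have gX: "g -` X \<inter> {1..n} = {1..n}" using bij_betw_imp_surj_on[OF g] by blast
  have weight_\<psi>: "weight (\<psi> x) = card {p \<in> X. \<phi> x p \<noteq> 0}" for x
  proof -
    have "{i. \<psi> x i \<noteq> 0} = {i \<in> {1..n}. \<psi> x i \<noteq> 0}" unfolding \<psi>_def by auto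
    then show ?thesis using card_pre[OF subset_refl, of x] unfolding weight_def gX by simp
  qed
  have \<psi>_diff: "\<psi> (x - y) = \<psi> x - \<psi> y" for x y
    by (auto simp: \<psi>_def diff fun_eq_iff)
  \<comment> \<open>The positive distance makes the encoding injective, so the 4^k messages give
    dimension k.\<close>
  have nonzero: "x = 0" if "x \<in> M" "\<psi> x = 0" for x
  proof (rule ccontr)
    assume "x \<noteq> 0"
    then have "d \<le> weight (\<psi> x)" using dist[OF that(1)] weight_\<psi> by simp
    then show False using par(3) that(2) by (simp add: weight_def)
  qed
  have "inj_on \<psi> M"
  proof (rule inj_onI)
    fix x y assume "x \<in> M" "y \<in> M" "\<psi> x = \<psi> y"
    then have "x - y = 0" using nonzero[of "x - y"] M(3) \<psi>_diff by simp
    then show "x = y" by simp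
  qed
  then have card_C: "card (\<psi> ` M) = CARD('a) ^ k"
    using M(1) field by (simp add: card_image)
  have ff: "finite (UNIV :: 'a set)" using field card.infinite by fastforce
  have sub: "word.subspace (\<psi> ` M)"
  proof (rule word.subspaceI)
    have \<psi>0: "\<psi> 0 = 0" using \<psi>_diff[of 0 0] by simp
    from image_eqI[where f = \<psi>, OF this[symmetric] M(2)] show "0 \<in> \<psi> ` M" .
    fix u v a assume u: "u \<in> \<psi> ` M"
    then obtain x where x: "x \<in> M" "u = \<psi> x" by blast
    obtain y where y: "y \<in> M" "\<forall>p. \<phi> y p = a * \<phi> x p" using scale[OF x(1)] by blast
    have "word_scale a u = \<psi> y" using x(2) y(2) by (auto simp: word_scale_def \<psi>_def)
    then show "word_scale a u \<in> \<psi> ` M" using y(1) by blast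
    assume v: "v \<in> \<psi> ` M"
    then obtain z where z: "z \<in> M" "v = \<psi> z" by blast
    have "u + v = \<psi> (x - (0 - z))" unfolding \<psi>_diff x(2) z(2) \<psi>0 by simp
    moreover have "x - (0 - z) \<in> M" using M(2,3) x(1) z(1) by blast
    ultimately show "u + v \<in> \<psi> ` M" by (rule image_eqI)
  qed
  have words: "\<psi> ` M \<subseteq> words {1..n}" by (auto simp: words_def \<psi>_def)
  then have fin: "finite (\<psi> ` M)" using finite_words[OF ff] finite_subset by blast
  have "CARD('a) ^ word.dim (\<psi> ` M) = CARD('a) ^ k"
    using card_subspace[OF sub fin] card_C by simp
  then have dim: "word.dim (\<psi> ` M) = k"
    using power_inject_exp[OF card_field_gt_1[OF ff]] by blast
  have "odd_lrc n d (\<psi> ` M) k"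
  proof
    show "CARD('a) = 4" "\<psi> ` M \<subseteq> words {1..n}" "word.subspace (\<psi> ` M)" "word.dim (\<psi> ` M) = k"
      "odd k" "k \<ge> 3" "d \<ge> 5" "n = d + 2 * (k - 1)"
      using field words sub dim par by auto
    show "d \<le> weight c" if c: "c \<in> \<psi> ` M" "c \<noteq> 0" for c
    proof -
      obtain x where x: "x \<in> M" "c = \<psi> x" using c(1) by blast
      have "\<psi> 0 = 0" using \<psi>_diff[of 0 0] by simp
      then have "x \<noteq> 0" using x c(2) by blast
      then show ?thesis using dist[OF x(1)] weight_\<psi> x(2) by simp
    qed
    fix i assume i: "i \<in> {1..n}"
    then have "g i \<in> X" using bij_betwE[OF g] by blast
    from loc[OF this] obtain R where R: "R \<subseteq> X" "g i \<in> R" "card R = 4"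
      "\<And>x. x \<in> M \<Longrightarrow> \<exists>q\<in>R. \<phi> x q \<noteq> 0 \<Longrightarrow> 3 \<le> card {q \<in> R. \<phi> x q \<noteq> 0}"
      by blast
    let ?R = "g -` R \<inter> {1..n}"
    have "card ?R \<le> card R"
    proof (rule card_inj_on_le[of g])
      show "inj_on g ?R" by (rule inj_on_subset[OF bij_betw_imp_inj_on[OF g]]) blast
      show "finite R" using R(3) card.infinite by fastforce
    qed blast
    then have "repair_group (\<psi> ` M) ?R"
      unfolding repair_group_def
    proof (intro conjI ballI impI)
      fix c assume "c \<in> \<psi> ` M" "\<exists>i\<in>?R. c i \<noteq> 0"
      then obtain x j where x: "x \<in> M" "c = \<psi> x" "j \<in> ?R" "\<psi> x j \<noteq> 0" by blast
      then have "g j \<in> R" "\<phi> x (g j) \<noteq> 0" by (auto simp: \<psi>_def split: if_splits)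
      then show "3 \<le> card {i \<in> ?R. c i \<noteq> 0}"
        unfolding x(2) card_pre[OF R(1)] using R(4)[OF x(1)] by blast
    qed (use R(3) in auto)
    then show "\<exists>R\<subseteq>{1..n}. i \<in> R \<and> repair_group (\<psi> ` M) R"
      using i R(2) by (intro exI[of _ ?R]) auto
  qed
  then show ?thesis using odd_lrc.optimal by blast
qed

section \<open>Constructions\<close>

lemma card_affine_nonzero:
  fixes a b :: "'a::field"
  assumes "CARD('a) = 4"
  shows "a \<noteq> 0 \<or> b \<noteq> 0 \<Longrightarrow> card {x. a + b * x \<noteq> 0} \<ge> 3"
    and "a \<noteq> 0 \<Longrightarrow> b = 0 \<Longrightarrow> card {x. a + b * x \<noteq> 0} = 4"
proof -
  have fin: "finite (UNIV :: 'a set)" using assms card.infinite by fastforce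
  show "card {x. a + b * x \<noteq> 0} = 4" if "a \<noteq> 0" "b = 0"
    using that assms by simp
  show "card {x. a + b * x \<noteq> 0} \<ge> 3" if ab: "a \<noteq> 0 \<or> b \<noteq> 0"
  proof -
    \<comment> \<open>For b = 0 the left side is empty, so the conventional value of
      \<open>- a / 0\<close> does no harm.\<close>
    have "{x. a + b * x = 0} \<subseteq> {- a / b}"
    proof
      fix x assume "x \<in> {x. a + b * x = 0}"
      then have x: "a + b * x = 0" by simp
      then have "b \<noteq> 0" using ab by auto
      moreover have "b * x = - a" using x by (simp add: eq_neg_iff_add_eq_0 add.commute)
      ultimately show "x \<in> {- a / b}" using eq_divide_imp[of b x "- a"] by (simp add: mult.commute)
    qed
    then have "UNIV - {- a / b} \<subseteq> {x. a + b * x \<noteq> 0}" by blast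
    then have "card (UNIV - {- a / b}) \<le> card {x. a + b * x \<noteq> 0}"
      by (rule card_mono[OF finite_subset[OF subset_UNIV fin]])
    moreover have "card (UNIV - {- a / b}) = 3"
      using card_Diff_singleton[of "- a / b" UNIV] assms by simp
    ultimately show ?thesis by linarith
  qed
qed

text \<open>Both counts go row by row. A row with nonzero slope contributes at least 3; when all
  slopes vanish, each row is constant and contributes 0 or 4.\<close>

lemma card_group_product:
  fixes a b :: "'j \<Rightarrow> 'a::field"
  assumes "CARD('a) = 4" "finite J"
  shows "3 * card {j \<in> J. b j \<noteq> 0} \<le> card {p \<in> J \<times> UNIV. a (fst p) + b (fst p) * snd p \<noteq> 0}"
    and "\<forall>j\<in>J. b j = 0 \<Longrightarrow>
      card {p \<in> J \<times> UNIV. a (fst p) + b (fst p) * snd p \<noteq> 0} = 4 * card {j \<in> J. a j \<noteq> 0}"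
proof -
  let ?f = "\<lambda>j. {x. a j + b j * x \<noteq> 0}"
  have fin: "finite (UNIV :: 'a set)" using assms card.infinite by fastforce
  have ff: "finite (?f j)" for j by (rule finite_subset[OF subset_UNIV fin])
  have "{p \<in> J \<times> UNIV. a (fst p) + b (fst p) * snd p \<noteq> 0} = Sigma J ?f" by auto
  then have W: "card {p \<in> J \<times> UNIV. a (fst p) + b (fst p) * snd p \<noteq> 0} = (\<Sum>j\<in>J. card (?f j))"
    using assms(2) ff by simp
  have "3 * card {j \<in> J. b j \<noteq> 0} = (\<Sum>j\<in>{j \<in> J. b j \<noteq> 0}. 3)" by simp
  also have "\<dots> \<le> (\<Sum>j\<in>{j \<in> J. b j \<noteq> 0}. card (?f j))"
    using card_affine_nonzero(1)[OF assms(1)] by (intro sum_mono) blast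
  also have "\<dots> \<le> (\<Sum>j\<in>J. card (?f j))"
    using assms(2) by (intro sum_mono2) auto
  finally show "3 * card {j \<in> J. b j \<noteq> 0} \<le>
      card {p \<in> J \<times> UNIV. a (fst p) + b (fst p) * snd p \<noteq> 0}"
    unfolding W .
  assume b: "\<forall>j\<in>J. b j = 0"
  have "(\<Sum>j\<in>J. card (?f j)) = (\<Sum>j\<in>J. if a j \<noteq> 0 then 4 else 0)"
    using b assms(1) by (intro sum.cong) auto
  also have "\<dots> = (\<Sum>j\<in>{j \<in> J. a j \<noteq> 0}. 4)"
    by (rule sum.inter_filter[OF assms(2), symmetric])
  finally show "card {p \<in> J \<times> UNIV. a (fst p) + b (fst p) * snd p \<noteq> 0} = 4 * card {j \<in> J. a j \<noteq> 0}"
    unfolding W by simp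
qed

section \<open>Reed-Solomon codes\<close>

definition polys :: "nat \<Rightarrow> 'a::field poly set" where
  "polys k = {p. \<forall>i\<ge>k. coeff p i = 0}"

text \<open>\<open>pCons\<close> splits off the constant coefficient. The induction can start at 0
  because \<open>polys 0\<close> contains the zero polynomial, which the condition
  \<open>degree p < 0\<close> would exclude.\<close>

lemma card_polys: "card (polys k :: 'a::field poly set) = CARD('a) ^ k"
proof (induction k)
  case 0
  have "polys 0 = {0 :: 'a poly}" by (auto simp: polys_def poly_eq_iff)
  then show ?case by simp
next
  case (Suc k)
  have "bij_betw (\<lambda>(a, p). pCons a p) (UNIV \<times> polys k) (polys (Suc k) :: 'a poly set)"
  proof (rule bij_betw_imageI)
    show "inj_on (\<lambda>(a, p). pCons a p) (UNIV \<times> (polys k :: 'a poly set))"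
      by (auto simp: inj_on_def)
    show "(\<lambda>(a, p). pCons a p) ` (UNIV \<times> polys k) = (polys (Suc k) :: 'a poly set)"
    proof
      show "(\<lambda>(a, p). pCons a p) ` (UNIV \<times> polys k) \<subseteq> (polys (Suc k) :: 'a poly set)"
        by (auto simp: polys_def coeff_pCons split: nat.splits)
      show "(polys (Suc k) :: 'a poly set) \<subseteq> (\<lambda>(a, p). pCons a p) ` (UNIV \<times> polys k)"
      proof
        fix p :: "'a poly" assume p: "p \<in> polys (Suc k)"
        obtain a q where q: "p = pCons a q" by (rule pCons_cases)
        have "coeff q i = 0" if "i \<ge> k" for i
        proof -
          have "coeff p (Suc i) = 0" using p that by (simp add: polys_def)
          then show ?thesis using q by simp
        qed
        then have "q \<in> polys k" by (simp add: polys_def)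
        then show "p \<in> (\<lambda>(a, p). pCons a p) ` (UNIV \<times> polys k)" using q by force
      qed
    qed
  qed
  from bij_betw_same_card[OF this] show ?case
    using Suc by (simp add: card_cartesian_product)
qed

lemma polys_closed:
  "0 \<in> polys k" "p \<in> polys k \<Longrightarrow> q \<in> polys k \<Longrightarrow> p - q \<in> polys k"
  "p \<in> polys k \<Longrightarrow> smult c p \<in> polys k"
  by (auto simp: polys_def)

text \<open>A nonzero polynomial of degree at most k - 1 has at most k - 1 roots among the four
  field elements.\<close>

lemma rs_weight:
  fixes p :: "'a::field poly"
  assumes "CARD('a) = 4" "p \<in> polys k" "p \<noteq> 0"
  shows "5 \<le> card {x. poly p x \<noteq> 0} + k"
proof -
  have fin: "finite (UNIV :: 'a set)" using assms card.infinite by fastforce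
  have "\<not> k \<le> degree p"
  proof
    assume "k \<le> degree p"
    then have "coeff p (degree p) = 0" using assms(2) by (simp add: polys_def)
    then show False using assms(3) by simp
  qed
  moreover have "card {x. poly p x = 0} \<le> degree p" by (rule card_poly_roots_bound[OF assms(3)])
  moreover have "{x. poly p x \<noteq> 0} = UNIV - {x. poly p x = 0}" by blast
  then have "card {x. poly p x \<noteq> 0} = 4 - card {x. poly p x = 0}"
    using card_Diff_subset[of "{x. poly p x = 0}" UNIV] fin assms(1)
      finite_subset[OF subset_UNIV fin] by simp
  ultimately show ?thesis by linarith
qed

text \<open>Reed--Solomon evaluation extended by the point at infinity \<open>None\<close>.\<close>

definition rs_eval :: "nat \<Rightarrow> 'a::field poly \<Rightarrow> 'a option \<Rightarrow> 'a" where
  "rs_eval k p j = (case j of None \<Rightarrow> coeff p (k - 1) | Some x \<Rightarrow> poly p x)"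

text \<open>Either the coordinate \<open>None\<close> is nonzero and adds one to the weight, or the
  degree drops and the Reed-Solomon bound improves by one.\<close>

lemma rs_eval_weight:
  fixes p :: "'a::field poly"
  assumes "CARD('a) = 4" "p \<in> polys k" "p \<noteq> 0"
  shows "6 \<le> card {j. rs_eval k p j \<noteq> 0} + k"
proof -
  have fin: "finite (UNIV :: 'a set)" using assms card.infinite by fastforce
  have "UNIV = insert None (range (Some :: 'a \<Rightarrow> _))" by (rule UNIV_option_conv)
  then have fino: "finite (UNIV :: 'a option set)" using fin by simp
  let ?S = "{j. rs_eval k p j \<noteq> 0}"
  have fS: "finite ?S" by (rule finite_subset[OF subset_UNIV fino])
  have Some: "card (Some ` {x. poly p x \<noteq> 0}) = card {x. poly p x \<noteq> 0}"
    by (intro card_image) simp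
  have sub: "Some ` {x. poly p x \<noteq> 0} \<subseteq> ?S" by (auto simp: rs_eval_def)
  show ?thesis
  proof (cases "coeff p (k - 1) = 0")
    case False
    have "Suc (card (Some ` {x. poly p x \<noteq> 0})) = card (insert None (Some ` {x. poly p x \<noteq> 0}))"
      using finite_subset[OF sub fS] by (subst card_insert_disjoint) auto
    also have "\<dots> \<le> card ?S"
      using sub False by (intro card_mono[OF fS]) (auto simp: rs_eval_def)
    finally show ?thesis using rs_weight[OF assms] Some by linarith
  next
    case True
    have p: "p \<in> polys (k - 1)"
    proof -
      have "coeff p i = 0" if "i \<ge> k - 1" for i
        using that assms(2) True by (cases "i = k - 1") (auto simp: polys_def)
      then show ?thesis by (simp add: polys_def)
    qed
    \<comment> \<open>For k = 0 truncated subtraction would make k - 1 equal to k, and passing to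
      \<open>polys (k - 1)\<close> would gain nothing.\<close>
    have "k \<noteq> 0"
    proof
      assume "k = 0"
      then have "p = 0" using assms(2) by (simp add: polys_def poly_eq_iff)
      then show False using assms(3) by simp
    qed
    moreover have "card (Some ` {x. poly p x \<noteq> 0}) \<le> card ?S" by (rule card_mono[OF fS sub])
    ultimately show ?thesis using rs_weight[OF assms(1) p assms(3)] Some by linarith
  qed
qed

text \<open>A group \<open>{j} \<times> UNIV\<close> carries the evaluations of \<open>a j + b j * x\<close>, a [4,2,3] code in which
  exactly the words with \<open>b j = 0\<close> have weight 4.\<close>

lemma exists_group_product_code:
  fixes EA EB :: "'a::field poly \<Rightarrow> 'j \<Rightarrow> 'a" and J :: "'j set"
  assumes field: "CARD('a) = 4" and J: "finite J"
    and diff: "\<And>p q j. EA (p - q) j = EA p j - EA q j" "\<And>p q j. EB (p - q) j = EB p j - EB q j"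
    and scale: "\<And>c p j. EA (smult c p) j = c * EA p j" "\<And>c p j. EB (smult c p) j = c * EB p j"
    and dist: "\<And>p. p \<in> polys kA \<Longrightarrow> p \<noteq> 0 \<Longrightarrow> d \<le> 4 * card {j \<in> J. EA p j \<noteq> 0}"
      "\<And>p. p \<in> polys kB \<Longrightarrow> p \<noteq> 0 \<Longrightarrow> d \<le> 3 * card {j \<in> J. EB p j \<noteq> 0}"
    and par: "odd (kA + kB)" "kA + kB \<ge> 3" "d \<ge> 5" "4 * card J = d + 2 * (kA + kB - 1)"
  shows "\<exists>C :: (nat \<Rightarrow> 'a) set. optimal_LRC_code (4 * card J) (kA + kB) d 2 3 C"
proof -
  let ?M = "polys kA \<times> polys kB :: ('a poly \<times> 'a poly) set"
  let ?\<phi> = "\<lambda>m p. EA (fst m) (fst p) + EB (snd m) (fst p) * snd p"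
  have fin: "finite (UNIV :: 'a set)" using field card.infinite by fastforce
  show ?thesis
  proof (rule exists_optimal_code[where \<phi> = ?\<phi> and X = "J \<times> UNIV" and M = "?M"])
    show "finite (J \<times> (UNIV :: 'a set))" using J fin by simp
    show "card (J \<times> (UNIV :: 'a set)) = 4 * card J" using field by (simp add: card_cartesian_product)
    show "card ?M = 4 ^ (kA + kB)"
      using field by (simp add: card_cartesian_product card_polys power_add)
    show "0 \<in> ?M" by (simp add: polys_closed zero_prod_def)
    show "x - y \<in> ?M" if "x \<in> ?M" "y \<in> ?M"
      for x y :: "'a poly \<times> 'a poly"
      using that polys_closed(2) by (auto simp: mem_Times_iff)
    show "?\<phi> (x - y) p = ?\<phi> x p - ?\<phi> y p" for x y p
      by (simp add: diff algebra_simps)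
    show "\<exists>y\<in>?M. \<forall>p. ?\<phi> y p = a * ?\<phi> x p" if "x \<in> ?M" for a x
    proof (rule bexI[of _ "(smult a (fst x), smult a (snd x))"])
      show "\<forall>p. ?\<phi> (smult a (fst x), smult a (snd x)) p = a * ?\<phi> x p"
        by (simp add: scale algebra_simps)
      show "(smult a (fst x), smult a (snd x)) \<in> ?M"
        using that by (auto simp: polys_closed)
    qed
    show "d \<le> card {p \<in> J \<times> UNIV. ?\<phi> x p \<noteq> 0}" if x: "x \<in> ?M" "x \<noteq> 0" for x
    \<comment> \<open>A nonzero slope polynomial gives weight 3 on each row where its encoding is
      nonzero. A zero one leaves constant rows, of weight 4 wherever the encoding of
      \<open>fst x\<close> is nonzero.\<close>
    proof (cases "snd x = 0")
      case False
      then show ?thesis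
        using dist(2)[of "snd x"] x(1)
          card_group_product(1)[OF field J, of "EB (snd x)" "EA (fst x)"] by (auto simp: mem_Times_iff)
    next
      case True
      then have "fst x \<noteq> 0" using x(2) by (metis prod_eqI fst_zero snd_zero)
      moreover have "EB (snd x) j = 0" for j using True diff(2)[of 0 0 j] by simp
      ultimately show ?thesis
        using dist(1)[of "fst x"] x(1)
          card_group_product(2)[OF field J, of "EB (snd x)" "EA (fst x)"] by (auto simp: mem_Times_iff)
    qed
    fix p :: "'j \<times> 'a" assume p: "p \<in> J \<times> UNIV"
    let ?R = "Pair (fst p) ` (UNIV :: 'a set)"
    have "3 \<le> card {q \<in> ?R. ?\<phi> x q \<noteq> 0}" if "\<exists>q\<in>?R. ?\<phi> x q \<noteq> 0" for x
    proof -
      let ?a = "EA (fst x) (fst p)" and ?b = "EB (snd x) (fst p)"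
      have "{q \<in> ?R. ?\<phi> x q \<noteq> 0} = Pair (fst p) ` {t. ?a + ?b * t \<noteq> 0}" by auto
      moreover have "card (Pair (fst p) ` {t. ?a + ?b * t \<noteq> 0}) = card {t. ?a + ?b * t \<noteq> 0}"
        by (intro card_image inj_onI) simp
      moreover have "?a \<noteq> 0 \<or> ?b \<noteq> 0" using that by auto
      then have "3 \<le> card {t. ?a + ?b * t \<noteq> 0}" by (rule card_affine_nonzero(1)[OF field])
      ultimately show ?thesis by simp
    qed
    moreover have "card ?R = 4" using field card_image[of "Pair (fst p)" "UNIV :: 'a set"] by (simp add: inj_on_def)
    moreover have "p \<in> ?R" by (cases p) auto
    moreover have "?R \<subseteq> J \<times> UNIV" using p by auto
    ultimately show "\<exists>R\<subseteq>J \<times> UNIV. p \<in> R \<and> card R = 4 \<and>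
        (\<forall>x\<in>?M. (\<exists>q\<in>R. ?\<phi> x q \<noteq> 0) \<longrightarrow> 3 \<le> card {q \<in> R. ?\<phi> x q \<noteq> 0})"
      by (intro exI[of _ ?R]) blast
  qed (use field par in auto)
qed

section \<open>Codes of dimension three from the affine plane\<close>

text \<open>The code consists of the affine functions on the plane, restricted to \<open>X\<close>; every line
  inside \<open>X\<close> is a repair group.\<close>

lemma exists_affine_plane_code:
  fixes X :: "('a::field \<times> 'a) set"
  assumes field: "CARD('a) = 4" and card_X: "card X = d + 4" and d: "d \<ge> 5"
    and lines: "\<And>u v. (u, v) \<in> X \<Longrightarrow> \<exists>\<beta> \<gamma>. (\<beta> \<noteq> 0 \<or> \<gamma> \<noteq> 0) \<and> (\<forall>t. (u + \<beta> * t, v + \<gamma> * t) \<in> X)"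
  shows "\<exists>C :: (nat \<Rightarrow> 'a) set. optimal_LRC_code (d + 4) 3 d 2 3 C"
proof -
  let ?\<phi> = "\<lambda>m p. (fst m + fst (snd m) * fst p) + snd (snd m) * snd p :: 'a"
  have fin: "finite (UNIV :: 'a set)" using field card.infinite by fastforce
  have finp: "finite (UNIV :: ('a \<times> 'a) set)" using finite_cartesian_product[OF fin fin] by simp
  show ?thesis
  proof (rule exists_optimal_code[where \<phi> = ?\<phi> and X = X and M = UNIV])
    show "finite X" by (rule finite_subset[OF subset_UNIV finp])
    show "CARD('a \<times> 'a \<times> 'a) = 4 ^ 3" using field by simp
    show "?\<phi> (x - y) p = ?\<phi> x p - ?\<phi> y p" for x y p by (simp add: algebra_simps)
    show "\<exists>y\<in>UNIV. \<forall>p. ?\<phi> y p = a * ?\<phi> x p" for a x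
      by (intro bexI[of _ "(a * fst x, a * fst (snd x), a * snd (snd x))"])
        (simp_all add: algebra_simps)
    show "d \<le> card {p \<in> X. ?\<phi> x p \<noteq> 0}" if x: "x \<noteq> 0" for x
    proof -
      let ?W = "{p \<in> UNIV \<times> UNIV. ?\<phi> x p \<noteq> 0}"
      \<comment> \<open>On the 16 points of the plane, a nonzero affine function vanishes nowhere or
        on a line of 4 points.\<close>
      have W: "12 \<le> card ?W"
      proof (cases "snd (snd x) = 0")
        case False
        then show ?thesis
          using card_group_product(1)[OF field fin,
              of "\<lambda>_. snd (snd x)" "\<lambda>j. fst x + fst (snd x) * j"] field by simp
      next
        case True
        then have "fst x \<noteq> 0 \<or> fst (snd x) \<noteq> 0"
          using x by (metis prod_eqI fst_zero snd_zero)
        then have "3 \<le> card {j. fst x + fst (snd x) * j \<noteq> 0}"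
          by (rule card_affine_nonzero(1)[OF field])
        then show ?thesis
          using card_group_product(2)[OF field fin,
              of "\<lambda>_. snd (snd x)" "\<lambda>j. fst x + fst (snd x) * j"] True by simp
      qed
      \<comment> \<open>The deleted points, 12 - d in number, can absorb at most 12 - d of these 12
        nonzero values.\<close>
      have "card (UNIV - X) = 16 - (d + 4)"
        using card_Diff_subset[OF finite_subset[OF subset_UNIV finp], of X UNIV] card_X field by simp
      moreover have "?W \<subseteq> {p \<in> X. ?\<phi> x p \<noteq> 0} \<union> (UNIV - X)" by blast
      then have "card ?W \<le> card ({p \<in> X. ?\<phi> x p \<noteq> 0} \<union> (UNIV - X))"
        by (rule card_mono[OF finite_subset[OF subset_UNIV finp]])
      then have "card ?W \<le> card {p \<in> X. ?\<phi> x p \<noteq> 0} + card (UNIV - X)"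
        using card_Un_le order_trans by blast
      moreover have "card X \<le> 16"
        using card_mono[OF finp subset_UNIV, of X] field by simp
      ultimately show ?thesis using W card_X by linarith
    qed
    fix p assume "p \<in> X"
    then obtain \<beta> \<gamma> where l: "\<beta> \<noteq> 0 \<or> \<gamma> \<noteq> 0" "\<And>t. (fst p + \<beta> * t, snd p + \<gamma> * t) \<in> X"
      using lines[of "fst p" "snd p"] by auto
    define h where "h t = (fst p + \<beta> * t, snd p + \<gamma> * t)" for t
    have inj: "inj_on h S" for S using l(1) by (auto simp: h_def inj_on_def)
    have "3 \<le> card {q \<in> range h. ?\<phi> x q \<noteq> 0}" if "\<exists>q\<in>range h. ?\<phi> x q \<noteq> 0" for x
    proof -
      define a b where "a = ?\<phi> x p" and "b = fst (snd x) * \<beta> + snd (snd x) * \<gamma>"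
      have ab: "?\<phi> x (h t) = a + b * t" for t
        by (simp add: h_def a_def b_def algebra_simps)
      then have "{q \<in> range h. ?\<phi> x q \<noteq> 0} = h ` {t. a + b * t \<noteq> 0}" by auto
      moreover have "a \<noteq> 0 \<or> b \<noteq> 0" using that ab by auto
      then have "3 \<le> card {t. a + b * t \<noteq> 0}" by (rule card_affine_nonzero(1)[OF field])
      ultimately show ?thesis using card_image[OF inj] by simp
    qed
    moreover have "card (range h) = 4" using card_image[OF inj] field by simp
    moreover have "p = h 0" by (simp add: h_def)
    then have "p \<in> range h" by blast
    moreover have "range h \<subseteq> X" using l(2) by (auto simp: h_def)
    ultimately show "\<exists>R\<subseteq>X. p \<in> R \<and> card R = 4 \<and>
        (\<forall>x\<in>UNIV. (\<exists>q\<in>R. ?\<phi> x q \<noteq> 0) \<longrightarrow> 3 \<le> card {q \<in> R. ?\<phi> x q \<noteq> 0})"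
      by (intro exI[of _ "range h"]) blast
  qed (use field d card_X in auto)
qed

text \<open>\<open>A\<close>, \<open>B\<close> and \<open>D\<close> select lines from three parallel
  classes, with directions (1, 0), (0, 1) and (1, -1). The assumption \<open>card\<close> counts the
  points missed by all of them.\<close>

lemma exists_union_of_lines_code:
  fixes A B D :: "'a::field set"
  assumes field: "CARD('a) = 4" and d: "d \<ge> 5"
    and card: "card {(u, v). v \<notin> A \<and> u \<notin> B \<and> u + v \<notin> D} + d = 12"
  shows "\<exists>C :: (nat \<Rightarrow> 'a) set. optimal_LRC_code (d + 4) 3 d 2 3 C"
proof (rule exists_affine_plane_code[OF field _ d])
  let ?X = "{(u, v). v \<in> A \<or> u \<in> B \<or> u + v \<in> D}"
  have fin: "finite (UNIV :: 'a set)" using field card.infinite by fastforce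
  have finp: "finite (UNIV :: ('a \<times> 'a) set)" using finite_cartesian_product[OF fin fin] by simp
  have "?X = UNIV - {(u, v). v \<notin> A \<and> u \<notin> B \<and> u + v \<notin> D}" by auto
  then have "card ?X = 16 - card {(u, v). v \<notin> A \<and> u \<notin> B \<and> u + v \<notin> D}"
    using card_Diff_subset[OF finite_subset[OF subset_UNIV finp],
        of "{(u, v). v \<notin> A \<and> u \<notin> B \<and> u + v \<notin> D}" UNIV] field by simp
  then show "card ?X = d + 4" using card by linarith
  fix u v assume "(u, v) \<in> ?X"
  then consider "v \<in> A" | "u \<in> B" | "u + v \<in> D" by blast
  then show "\<exists>\<beta> \<gamma>. (\<beta> \<noteq> 0 \<or> \<gamma> \<noteq> 0) \<and> (\<forall>t. (u + \<beta> * t, v + \<gamma> * t) \<in> ?X)"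
  proof cases
    case 1
    then show ?thesis by (intro exI[of _ 1] exI[of _ 0]) simp
  next
    case 2
    then show ?thesis by (intro exI[of _ 0] exI[of _ 1]) simp
  next
    case 3
    then show ?thesis by (intro exI[of _ 1] exI[of _ "-1"]) simp
  qed
qed

text \<open>The lines must miss 12 - d points. Two parallel classes miss (4 - a)(4 - b) points,
  which covers all cases but 7 and 5, primes above 4; for these one line of a third class is
  added.\<close>

lemma exists_optimal_code_dim_3:
  assumes field: "CARD('a::field) = 4" and d: "5 \<le> d" "d \<le> 12"
  shows "\<exists>C :: (nat \<Rightarrow> 'a) set. optimal_LRC_code (d + 4) 3 d 2 3 C"
proof -
  have fin: "finite (UNIV :: 'a set)" using field card.infinite by fastforce
  have compl: "card (- S) = 4 - card S" for S :: "'a set"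
    using card_Diff_subset[OF finite_subset[OF subset_UNIV fin], of S UNIV] field
    by (simp add: Compl_eq_Diff_UNIV)
  have two: "\<exists>C :: (nat \<Rightarrow> 'a) set. optimal_LRC_code (d + 4) 3 d 2 3 C"
    if "a \<le> 4" "b \<le> 4" "(4 - a) * (4 - b) + d = 12" for a b
  proof -
    have "a \<le> CARD('a)" "b \<le> CARD('a)" using that field by simp_all
    then obtain A B :: "'a set" where AB: "card A = a" "card B = b"
      using obtain_subset_with_card_n[of _ "UNIV :: 'a set"] by metis
    have "{(u, v). v \<notin> A \<and> u \<notin> B \<and> u + v \<notin> {}} = (- B) \<times> (- A)" by auto
    then have "card {(u, v). v \<notin> A \<and> u \<notin> B \<and> u + v \<notin> {}} + d = 12"
      using that(3) by (simp add: card_cartesian_product compl AB mult.commute)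
    then show ?thesis by (rule exists_union_of_lines_code[OF field d(1)])
  qed
  have three: "\<exists>C :: (nat \<Rightarrow> 'a) set. optimal_LRC_code (d + 4) 3 d 2 3 C"
    if "1 \<le> a" "a \<le> 2" "2 * (4 - a) + 1 + d = 12" for a
  proof -
    have "a - 1 \<le> card (UNIV - {0 :: 'a})" using compl[of "{0}"] that(2) by (simp add: Compl_eq_Diff_UNIV)
    then obtain A' where A': "A' \<subseteq> UNIV - {0 :: 'a}" "card A' = a - 1" "finite A'"
      by (rule obtain_subset_with_card_n)
    let ?A = "insert 0 A'"
    have A: "card ?A = a" using A' that(1) by (subst card_insert_disjoint) auto
    have "?A \<noteq> UNIV" using A that(2) field by auto
    then obtain s where s: "s \<notin> ?A" by blast
    \<comment> \<open>The points that the line u + v = s newly covers. Its point (0, s) is excluded,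
      as it already lies on the line u = 0; since s is outside \<open>?A\<close>, exactly 3 - a
      points remain.\<close>
    let ?L = "(\<lambda>v. (s - v, v)) ` (- insert s ?A)"
    have "{(u, v). v \<notin> ?A \<and> u \<notin> {0 :: 'a} \<and> u + v \<notin> {s}} = (- {0 :: 'a}) \<times> (- ?A) - ?L"
    proof -
      have "(u, v) \<in> ?L \<longleftrightarrow> v \<notin> ?A \<and> v \<noteq> s \<and> u + v = s" for u v
        by (auto simp: image_iff eq_diff_eq)
      moreover have "v \<noteq> s" if "u + v = s" "u \<noteq> 0" for u v using that by auto
      ultimately show ?thesis by blast
    qed
    moreover have "?L \<subseteq> (- {0 :: 'a}) \<times> (- ?A)" by auto
    moreover have "card ?L = 4 - Suc a"
      using s A A'(3) by (subst card_image) (auto simp: inj_on_def compl)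
    moreover have "card ((- {0 :: 'a}) \<times> (- ?A)) = 3 * (4 - a)"
      using A by (simp add: card_cartesian_product compl)
    ultimately have "card {(u, v). v \<notin> ?A \<and> u \<notin> {0 :: 'a} \<and> u + v \<notin> {s}} = 3 * (4 - a) - (4 - Suc a)"
      using card_Diff_subset[of ?L "(- {0 :: 'a}) \<times> (- ?A)"] finite_subset[OF subset_UNIV fin] by simp
    then have "card {(u, v). v \<notin> ?A \<and> u \<notin> {0 :: 'a} \<and> u + v \<notin> {s}} + d = 12"
      using that by linarith
    then show ?thesis by (rule exists_union_of_lines_code[OF field d(1)])
  qed
  consider "d = 5" | "d = 6" | "d = 7" | "d \<ge> 8" using d by linarith
  then show ?thesis
  proof cases
    case 1
    then show ?thesis using three[of 1] by simp
  next
    case 2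
    then show ?thesis using two[of 2 1] by simp
  next
    case 3
    then show ?thesis using three[of 2] by simp
  next
    case 4
    then show ?thesis using two[of 3 "d - 8"] d by simp
  qed
qed

text \<open>Reed-Solomon codes with parameters [4,3,2] and [4,2,3] give the weights 4 * 2 = 8 and 3
  * 3 = 9.\<close>

lemma exists_optimal_code_16_5_8:
  assumes "CARD('a::field) = 4"
  shows "\<exists>C :: (nat \<Rightarrow> 'a) set. optimal_LRC_code 16 5 8 2 3 C"
proof -
  have fin: "finite (UNIV :: 'a set)" using assms card.infinite by fastforce
  have "\<exists>C :: (nat \<Rightarrow> 'a) set. optimal_LRC_code (4 * CARD('a)) (3 + 2) 8 2 3 C"
  proof (rule exists_group_product_code[where EA = poly and EB = poly, OF assms fin])
    show "8 \<le> 4 * card {j \<in> UNIV. poly p j \<noteq> 0}" if "p \<in> polys 3" "p \<noteq> 0" for p :: "'a poly"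
      using rs_weight[OF assms that] by simp
    show "8 \<le> 3 * card {j \<in> UNIV. poly p j \<noteq> 0}" if "p \<in> polys 2" "p \<noteq> 0" for p :: "'a poly"
      using rs_weight[OF assms that] by simp
  qed (use assms in simp_all)
  then show ?thesis using assms by simp
qed

text \<open>The extended codes have length 5 and distance at least 6 - k. The last two conditions
  say d \<le> 4(6 - \<open>kA\<close>) and d \<le> 3(6 - \<open>kB\<close>).\<close>

lemma exists_optimal_code_20:
  assumes field: "CARD('a::field) = 4"
    and par: "odd (kA + kB)" "kA + kB \<ge> 3" "d \<ge> 5" "20 = d + 2 * (kA + kB - 1)"
    "d + 4 * kA \<le> 24" "d + 3 * kB \<le> 18"
  shows "\<exists>C :: (nat \<Rightarrow> 'a) set. optimal_LRC_code 20 (kA + kB) d 2 3 C"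
proof -
  have fin: "finite (UNIV :: 'a set)" using field card.infinite by fastforce
  then have fino: "finite (UNIV :: 'a option set)" and card: "CARD('a option) = 5"
    using field by (simp_all add: UNIV_option_conv card_image)
  have "\<exists>C :: (nat \<Rightarrow> 'a) set. optimal_LRC_code (4 * CARD('a option)) (kA + kB) d 2 3 C"
  proof (rule exists_group_product_code[where EA = "rs_eval kA" and EB = "rs_eval kB", OF field fino])
    show "d \<le> 4 * card {j \<in> UNIV. rs_eval kA p j \<noteq> 0}" if "p \<in> polys kA" "p \<noteq> 0" for p :: "'a poly"
      using rs_eval_weight[OF field that] par(5) by simp
    show "d \<le> 3 * card {j \<in> UNIV. rs_eval kB p j \<noteq> 0}" if "p \<in> polys kB" "p \<noteq> 0" for p :: "'a poly"
      using rs_eval_weight[OF field that] par(6) by simp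
  qed (use par card in \<open>simp_all add: rs_eval_def split: option.split\<close>)
  then show ?thesis unfolding card by simp
qed

section \<open>The classification\<close>

lemma optimal_code_parameters:
  fixes C :: "(nat \<Rightarrow> 'a::field) set"
  assumes field: "CARD('a) = 4" and k: "k \<ge> 3" and d: "d \<ge> 5"
    and C: "optimal_LRC_code n k d 2 3 C"
  shows "(n = d + 4 \<and> k = 3 \<and> 5 \<le> d \<and> d \<le> 12) \<or>
    (d = 8 \<and> ((n, k) = (16, 5) \<or> (n, k) = (20, 7))) \<or>
    (d = 12 \<and> (n, k) = (20, 5))"
proof -
  note lrc = lrc_if_optimal[OF field C]
  have "odd k"
  proof
    assume "even k"
    then obtain m where m: "k = 2 * m" by (rule evenE)
    have "n + 3 = d + 4 * m" using d_optimal_even lrc(3) m by blast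
    then have "d \<le> 4"
      using lrc.even_dim_bound[OF lrc(1), of m] lrc(2) m k by linarith
    then show False using d by simp
  qed
  moreover have n: "n = d + 2 * (k - 1)" using d_optimal_odd[OF \<open>odd k\<close>] lrc(3) by blast
  ultimately have odd: "odd_lrc n d C k"
    using lrc k d by (simp add: odd_lrc_def odd_lrc_axioms_def)
  show ?thesis
  proof (cases "k = 3")
    case True
    then show ?thesis using n d odd_lrc.d_le_12[OF odd] by simp
  next
    case False
    then have "k \<ge> 5" using k \<open>odd k\<close> by (cases "k = 4") auto
    then have "odd_lrc_5 n d C k" using odd by (simp add: odd_lrc_5_def odd_lrc_5_axioms_def)
    from odd_lrc_5.parameters[OF this] show ?thesis by blast
  qed
qed

theorem mainTheorem4:
  fixes n k d :: nat
  assumes "CARD('a::field) = 4"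
    and "k \<ge> 3" and "d \<ge> 5"
  shows "(\<exists>C :: (nat \<Rightarrow> 'a) set. optimal_LRC_code n k d 2 3 C) \<longleftrightarrow>
    (n = d + 4 \<and> k = 3 \<and> 5 \<le> d \<and> d \<le> 12) \<or>
    (d = 8 \<and> ((n, k) = (16, 5) \<or> (n, k) = (20, 7))) \<or>
    (d = 12 \<and> (n, k) = (20, 5))"
proof
  assume "\<exists>C :: (nat \<Rightarrow> 'a) set. optimal_LRC_code n k d 2 3 C"
  then show "(n = d + 4 \<and> k = 3 \<and> 5 \<le> d \<and> d \<le> 12) \<or>
    (d = 8 \<and> ((n, k) = (16, 5) \<or> (n, k) = (20, 7))) \<or>
    (d = 12 \<and> (n, k) = (20, 5))"
    using optimal_code_parameters[OF assms] by blast
next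
  \<comment> \<open>The splittings 7 = 4 + 3 and 5 = 3 + 2 give weights at least min(4 * 2, 3 * 3) =
    8 and min(4 * 3, 3 * 4) = 12.\<close>
  have "\<exists>C :: (nat \<Rightarrow> 'a) set. optimal_LRC_code 20 7 8 2 3 C"
    using exists_optimal_code_20[OF assms(1), of 4 3 8] by simp
  moreover have "\<exists>C :: (nat \<Rightarrow> 'a) set. optimal_LRC_code 20 5 12 2 3 C"
    using exists_optimal_code_20[OF assms(1), of 3 2 12] by simp
  moreover assume "(n = d + 4 \<and> k = 3 \<and> 5 \<le> d \<and> d \<le> 12) \<or>
    (d = 8 \<and> ((n, k) = (16, 5) \<or> (n, k) = (20, 7))) \<or>
    (d = 12 \<and> (n, k) = (20, 5))"
  ultimately show "\<exists>C :: (nat \<Rightarrow> 'a) set. optimal_LRC_code n k d 2 3 C"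
    using exists_optimal_code_dim_3[OF assms(1), of d] exists_optimal_code_16_5_8[OF assms(1)]
    by (elim disjE conjE) simp_all
qed

end
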